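(* Suppose that $\|x^0-x^\star\|_{x^\star}\le\beta$. Let $(\sigma,\beta,C)$ satisfy $$\sigma\in(0,1),\quad \beta\in(0,0.5),\quad C>1,\qquad \frac{1}{C(1-\beta)}+\frac{\beta}{(1-2\beta)(1-\beta)^2}\le\sigma,\qquad \frac1C+\frac{1}{1-2\beta}\le 2,$$ let $\eta_k:=\frac{\beta\sigma^k}{C}$, and let $\{x^k\}$ be updated by the full-step scheme described in the context. Then to obtain an $\varepsilon$-solution, i.e. a point $x_\varepsilon^\star$ with $\|x_\varepsilon^\star-x^\star\|_{x^\star}\le\varepsilon$, the scheme requires (i) $\mathcal{O}(\ln(\varepsilon^{-1}))$ gradient evaluations $\nabla f(x^k)$, (ii) $\mathcal{O}(\ln(\varepsilon^{-1}))$ Hessian evaluations $\nabla^2f(x^k)$, and (iii) $\mathcal{O}(\varepsilon^{-2\nu})$ LMO calls, with $\nu:=1+\frac{\ln(1-2\beta)}{\ln(\sigma)}$.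
   Context: Problem. Let $f:\mathbb{R}^p\to\mathbb{R}\cup\{+\infty\}$ be a proper, closed, convex function, three times continuously differentiable on its domain $\mathrm{dom}(f)$, and standard self-concordant: for all $x\in\mathrm{dom}(f)$, $v\in\mathbb{R}^p$, the function $\varphi(\tau):=f(x+\tau v)$ satisfies $|\varphi'''(\tau)|\le 2\varphi''(\tau)^{3/2}$ for all $\tau\in\mathrm{dom}(\varphi)$. The Hessian $\nabla^2 f(x)$ is nondegenerate (hence positive definite) for every $x\in\mathrm{dom}(f)$. Let $\mathcal{X}\subset\mathbb{R}^p$ be nonempty, compact and convex. The problem $f^\star=\min_{x\in\mathcal{X}}f(x)$ has a (necessarily unique) solution $x^\star$. Notation: $\|u\|_x := (u^\top\nabla^2 f(x)u)^{1/2}$. An LMO (linear minimization oracle) call returns, for given $s$, a point of $\arg\min_{u\in\mathcal{X}}\langle s,u\rangle$. Subroutine $\mathbf{FW}(q,H,u^0,\eta)$ ($q,u^0\in\mathbb{R}^p$, $H$ a symmetric positive definite matrix, $\eta>0$): for $t=0,1,\dots$: set $g^t:=q+H(u^t-u^0)$; choose $v^t\in\arg\max_{s\in\mathcal{X}}\langle g^t,u^t-s\rangle$ (one LMO call); set $V_t:=\langle g^t,u^t-v^t\rangle$. If $V_t>\eta$, set $\delta_t:=(v^t-u^t)^\top H(v^t-u^t)$, $\tau_t:=\min\{1,V_t/\delta_t\}$, $u^{t+1}:=(1-\tau_t)u^t+\tau_tv^t$; otherwise return $u^t$. Full-step scheme: starting from $x^0\in\mathrm{dom}(f)\cap\mathcal{X}$,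 for $k=0,1,\dots$ set $z^k:=\mathbf{FW}(\nabla f(x^k),\nabla^2f(x^k),x^k,\eta_k^2)$ and $x^{k+1}:=z^k$. Each outer iteration $k$ uses one gradient evaluation and one Hessian evaluation; LMO calls are counted over all FW runs. The $\mathcal{O}(\cdot)$ bounds are for small $\varepsilon>0$, with constants independent of $\varepsilon$ (they may depend on $f,\mathcal{X},x^0,\beta,\sigma,C$). *)

theory Defs
  imports "HOL-Analysis.Analysis" "HOL-Library.Landau_Symbols" "HOL-Library.While_Combinator"
begin

section \<open>Extended-valued convex functions\<close>

definition edom :: "('a \<Rightarrow> ereal) \<Rightarrow> 'a set" where
  "edom f = {x. f x < \<infinity>}"

definition proper_fun :: "('a \<Rightarrow> ereal) \<Rightarrow> bool" where
  "proper_fun f \<longleftrightarrow> (\<forall>x. f x \<noteq> -\<infinity>) \<and> edom f \<noteq> {}"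

text \<open>The library's \<^const>\<open>epigraph\<close> is for real-valued functions only.\<close>

definition eepigraph :: "('a \<Rightarrow> ereal) \<Rightarrow> ('a \<times> real) set" where
  "eepigraph f = {(x, r). f x \<le> ereal r}"

definition closed_fun :: "('a::topological_space \<Rightarrow> ereal) \<Rightarrow> bool" where
  "closed_fun f \<longleftrightarrow> closed (eepigraph f)"

definition convex_fun :: "('a::real_vector \<Rightarrow> ereal) \<Rightarrow> bool" where
  "convex_fun f \<longleftrightarrow> convex (eepigraph f)"

text \<open>The finite values of \<open>f\<close>. Off \<open>edom f\<close> the value is the junk value 0; derivatives of
  \<open>finite_part f\<close> are only ever taken at points of \<open>edom f\<close>, which is assumed open.\<close>

definition finite_part :: "('a \<Rightarrow> ereal) \<Rightarrow> 'a \<Rightarrow> real" where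
  "finite_part f x = real_of_ereal (f x)"

section \<open>Derivatives and self-concordance\<close>

text \<open>\<open>C_k_on n f S\<close> means that \<open>f\<close> is \<open>n\<close> times continuously differentiable on the open set
  \<open>S\<close>: in finite dimension, continuity of the \<open>n\<close>-th derivative is continuity of all
  iterated directional derivatives of order \<open>n\<close>.\<close>

primrec C_k_on :: "nat \<Rightarrow> ('a::real_normed_vector \<Rightarrow> 'b::real_normed_vector) \<Rightarrow> 'a set \<Rightarrow> bool" where
  "C_k_on 0 f S \<longleftrightarrow> continuous_on S f"
| "C_k_on (Suc n) f S \<longleftrightarrow>
     (\<forall>x\<in>S. f differentiable (at x)) \<and> (\<forall>h. C_k_on n (\<lambda>x. frechet_derivative f (at x) h) S)"

definition gradient :: "(real^'p \<Rightarrow> real) \<Rightarrow> real^'p \<Rightarrow> real^'p" where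
  "gradient g x = (THE D. GDERIV g x :> D)"

definition hessian :: "(real^'p \<Rightarrow> real) \<Rightarrow> real^'p \<Rightarrow> real^'p^'p" where
  "hessian g x = jacobian (gradient g) (at x)"

definition C3_on_domain :: "(real^'p \<Rightarrow> ereal) \<Rightarrow> bool" where
  "C3_on_domain f \<longleftrightarrow> open (edom f) \<and> C_k_on 3 (finite_part f) (edom f)"

definition standard_self_concordant :: "(real^'p \<Rightarrow> ereal) \<Rightarrow> bool" where
  "standard_self_concordant f \<longleftrightarrow>
     (\<forall>x\<in>edom f. \<forall>v. let \<phi> = (\<lambda>\<tau>::real. finite_part f (x + \<tau> *\<^sub>R v)) in
        \<forall>\<tau>. x + \<tau> *\<^sub>R v \<in> edom f \<longrightarrow>
          \<bar>(deriv ^^ 3) \<phi> \<tau>\<bar> \<le> 2 * ((deriv ^^ 2) \<phi> \<tau>) powr (3/2))"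

definition local_norm :: "(real^'p \<Rightarrow> ereal) \<Rightarrow> real^'p \<Rightarrow> real^'p \<Rightarrow> real" where
  "local_norm f x u = sqrt (u \<bullet> (hessian (finite_part f) x *v u))"

section \<open>The Frank-Wolfe subroutine\<close>

definition is_LMO :: "(real^'p) set \<Rightarrow> (real^'p \<Rightarrow> real^'p) \<Rightarrow> bool" where
  "is_LMO X lmo \<longleftrightarrow> (\<forall>s. is_arg_min (\<lambda>u. s \<bullet> u) (\<lambda>u. u \<in> X) (lmo s))"

text \<open>The oracle \<open>lmo t\<close> answers the call made at step \<open>t\<close>, so that ties may be broken
  differently at different steps. A minimizer of \<open>\<langle>g, s\<rangle>\<close> over \<open>s \<in> X\<close> is a maximizer of
  \<open>\<langle>g, u - s\<rangle>\<close>.\<close>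

definition FW_grad :: "real^'p \<Rightarrow> real^'p^'p \<Rightarrow> real^'p \<Rightarrow> real^'p \<Rightarrow> real^'p" where
  "FW_grad q H u0 u = q + H *v (u - u0)"

definition FW_gap ::
  "(nat \<Rightarrow> real^'p \<Rightarrow> real^'p) \<Rightarrow> real^'p \<Rightarrow> real^'p^'p \<Rightarrow> real^'p \<Rightarrow> nat \<Rightarrow> real^'p \<Rightarrow> real" where
  "FW_gap lmo q H u0 t u = (let g = FW_grad q H u0 u in g \<bullet> (u - lmo t g))"

definition FW_step ::
  "(nat \<Rightarrow> real^'p \<Rightarrow> real^'p) \<Rightarrow> real^'p \<Rightarrow> real^'p^'p \<Rightarrow> real^'p \<Rightarrow> nat \<Rightarrow> real^'p \<Rightarrow> real^'p" where
  "FW_step lmo q H u0 t u =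
     (let v = lmo t (FW_grad q H u0 u);
          V = FW_gap lmo q H u0 t u;
          \<delta> = (v - u) \<bullet> (H *v (v - u));
          \<tau> = min 1 (V / \<delta>)
      in (1 - \<tau>) *\<^sub>R u + \<tau> *\<^sub>R v)"

text \<open>\<open>FW\<close> returns the final iterate and the number of LMO calls, or \<open>None\<close> if the stopping
  test never succeeds. Stopping at step \<open>t\<close> costs \<open>t + 1\<close> calls, because the stopping test
  itself needs the oracle's answer.\<close>

definition FW ::
  "(nat \<Rightarrow> real^'p \<Rightarrow> real^'p) \<Rightarrow> real^'p \<Rightarrow> real^'p^'p \<Rightarrow> real^'p \<Rightarrow> real \<Rightarrow> ((real^'p) \<times> nat) option" where
  "FW lmo q H u0 \<eta> =
     map_option (\<lambda>(t, u). (u, Suc t))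
       (while_option (\<lambda>(t, u). FW_gap lmo q H u0 t u > \<eta>)
                     (\<lambda>(t, u). (Suc t, FW_step lmo q H u0 t u))
                     (0, u0))"

section \<open>The full-step scheme\<close>

record 'p scheme_state =
  iterate :: "real^'p"
  gradient_evals :: nat
  hessian_evals :: nat
  lmo_calls :: nat

text \<open>\<open>full_step f \<eta> lmo x0 k\<close> is the state in which \<open>x\<^sup>k\<close> becomes available, with the costs
  accumulated in the outer iterations \<open>0, \<dots>, k - 1\<close> that produced it; it is \<open>None\<close> if one of the
  Frank-Wolfe runs needed for this does not terminate. The oracle \<open>lmo k t\<close> answers the call at
  inner step \<open>t\<close> of outer iteration \<open>k\<close>.\<close>

primrec full_step ::
  "(real^'p \<Rightarrow> ereal) \<Rightarrow> (nat \<Rightarrow> real) \<Rightarrow> (nat \<Rightarrow> nat \<Rightarrow> real^'p \<Rightarrow> real^'p) \<Rightarrow> real^'p \<Rightarrow> nat \<Rightarrow>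
     'p scheme_state option" where
  "full_step f \<eta> lmo x0 0 =
     Some \<lparr>iterate = x0, gradient_evals = 0, hessian_evals = 0, lmo_calls = 0\<rparr>"
| "full_step f \<eta> lmo x0 (Suc k) =
     (case full_step f \<eta> lmo x0 k of
        None \<Rightarrow> None
      | Some s \<Rightarrow>
         (case FW (lmo k) (gradient (finite_part f) (iterate s)) (hessian (finite_part f) (iterate s))
                  (iterate s) ((\<eta> k)\<^sup>2) of
            None \<Rightarrow> None
          | Some (z, n) \<Rightarrow>
              Some \<lparr>iterate = z,
                    gradient_evals = gradient_evals s + 1,
                    hessian_evals = hessian_evals s + 1,
                    lmo_calls = lmo_calls s + n\<rparr>))"

end

(*
  For a symmetric trilinear form on a Euclidean plane, u \<mapsto> T u u u restricted to the unit circle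
  is a trigonometric polynomial with frequencies 1 and 3, so self-concordance, which bounds the
  third derivative only on the diagonal, also bounds it on triples (u, u, v). Integrating along
  segments gives the Dikin ellipsoid, the comparison of Hessians and the gradient estimate
  r^2 / (1 - r). With the optimality of xstar, an inexact Newton step then contracts the error in
  the norm at xstar by the factor \<sigma>.

  All iterates stay in a Dikin ball around xstar, so their Hessians are uniformly bounded and a
  Frank-Wolfe run with tolerance \<eta>_k^2 needs O(1 / \<eta>_k^2) steps. The geometric sum over the outer
  iterations is O(\<epsilon>^-2), which suffices because \<nu> \<ge> 1.
*)
theory Submission
  imports Defs
begin

text \<open>Constants shape the proof. Ordinary polarization would bound T u u v by more than the
  diagonal constant 2; any such loss raises the power of 1 - r in the comparison of Hessians, spoils
  the gradient estimate and breaks the contraction condition on \<sigma>. The quadrature rule with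
  nonnegative weights loses nothing.

  An inexact Newton step from x to z is analysed by testing three inequalities against z - xstar:
  the Frank-Wolfe gap at z, the optimality of xstar and the gradient estimate at x. Let a be the
  length of z - xstar in the norm at x, and l \<le> \<beta> a bound on the distance from x to xstar
  in the norm at xstar. The result is a^2 \<le> \<eta>^2 + a B with B = l^2 / ((1 - 2 \<beta>) (1 -
  \<beta>)), so a gap tolerance \<eta>^2 costs only \<eta> in distance. Returning to the norm at
  xstar costs a factor 1 / (1 - \<beta>), and l^2 \<le> l \<beta> makes the bound linear: these are
  the two summands of the condition on \<sigma>. Since the distance in the norm at x is at most
  \<beta> / (1 - \<beta>), the gradient estimate applies because \<beta> < 1/2.\<close>

section \<open>Symmetric trilinear forms\<close>

text \<open>Write \<open>x = cos \<alpha>\<close> and \<open>y = sin \<alpha>\<close>. The left-hand side of the second claim is the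
  functional \<open>p \<mapsto> cos (3 \<alpha>) p(0) + sin (3 \<alpha>) p'(0) / 3\<close> applied to \<open>p(\<theta>) = P (cos \<theta>) (sin \<theta>)\<close>.
  It attains its norm 1 on \<open>cos (3 \<theta> - 3 \<alpha>)\<close>, so the nodes are the maximum points
  \<open>\<alpha> + 2 \<pi> j / 3\<close> of that function; the weights are squares, hence nonnegative.\<close>

lemma cubic_form_quadrature:
  fixes x y q p0 p1 p2 p3 :: real
  assumes xy: "x\<^sup>2 + y\<^sup>2 = 1" and q: "q\<^sup>2 = 3"
  defines "P \<equiv> \<lambda>c s. c^3 * p0 + 3 * c\<^sup>2 * s * p1 + 3 * c * s\<^sup>2 * p2 + s^3 * p3"
    and "w0 \<equiv> ((1 + 2 * (x\<^sup>2 - y\<^sup>2)) / 3)\<^sup>2"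
    and "w1 \<equiv> ((1 - (x\<^sup>2 - y\<^sup>2) + q * (2 * x * y)) / 3)\<^sup>2"
    and "w2 \<equiv> ((1 - (x\<^sup>2 - y\<^sup>2) - q * (2 * x * y)) / 3)\<^sup>2"
  shows "w0 + w1 + w2 = 1"
    and "(4 * x^3 - 3 * x) * p0 + (3 * y - 4 * y^3) * p1 =
      w0 * P x y + w1 * P (- x / 2 - q * y / 2) (- y / 2 + q * x / 2)
        + w2 * P (- x / 2 + q * y / 2) (- y / 2 - q * x / 2)"
proof -
  define a1 b1 a2 b2 where "a1 = - x / 2 - q * y / 2" and "b1 = - y / 2 + q * x / 2"
    and "a2 = - x / 2 + q * y / 2" and "b2 = - y / 2 - q * x / 2"
  note d = a1_def b1_def a2_def b2_def
  have d2: "2 * a1 = - (x + q * y)" "2 * b1 = q * x - y" "2 * a2 = q * y - x" "2 * b2 = - (y + q * x)"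
    by (simp_all add: d)
  have w: "9 * w0 = (1 + 2 * (x\<^sup>2 - y\<^sup>2))\<^sup>2" "9 * w1 = (1 - (x\<^sup>2 - y\<^sup>2) + q * (2 * x * y))\<^sup>2"
    "9 * w2 = (1 - (x\<^sup>2 - y\<^sup>2) - q * (2 * x * y))\<^sup>2"
    unfolding w0_def w1_def w2_def by (simp_all add: power_divide)
  have q2: "q * q = 3" using q by (simp add: power2_eq_square)
  have yy: "y * y = 1 - x * x" using xy by (simp add: power2_eq_square)
  \<comment> \<open>With \<open>q2\<close> and \<open>yy\<close>, these rules reduce every monomial
    to degree at most one in \<open>q\<close> and in \<open>y\<close>, a normal form modulo the two
    relations.\<close>
  have red: "q * (q * z) = 3 * z" "y * (y * z) = z - x * x * z" for z
    using q2 yy by (metis mult.assoc, metis mult.assoc left_diff_distrib mult_1)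
  show "w0 + w1 + w2 = 1"
    using w q xy by algebra
  \<comment> \<open>The rule is evaluated on the monomials c^3, c^2 s, c s^2 and s^3 separately; the
    factor 9 * 8 clears the denominators of weights and nodes.\<close>
  have c0: "w0 * x^3 + w1 * a1^3 + w2 * a2^3 = 4 * x^3 - 3 * x"
  proof -
    have "9*8*(w0 * x^3 + w1 * a1^3 + w2 * a2^3) = 8*(9*w0) * x^3 + (9*w1) * (2*a1)^3 + (9*w2) * (2*a2)^3"
      by (simp add: power_mult_distrib algebra_simps)
    also have "\<dots> = 72 * (4 * x^3 - 3 * x)"
      unfolding w d2
      by (simp add: power2_eq_square power3_eq_cube algebra_simps q2 yy red)
    finally show ?thesis by simp
  qed
  have c1: "3 * (w0 * (x\<^sup>2 * y) + w1 * (a1\<^sup>2 * b1) + w2 * (a2\<^sup>2 * b2)) = 3 * y - 4 * y^3"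
  proof -
    have "9*8*(w0 * (x\<^sup>2 * y) + w1 * (a1\<^sup>2 * b1) + w2 * (a2\<^sup>2 * b2)) 
      = 8*(9*w0) * (x\<^sup>2 * y) + (9*w1) * ((2*a1)^2 * (2*b1)) + (9*w2) * ((2*a2)^2 * (2*b2))"
      by (simp add: power_mult_distrib algebra_simps)
    also have "3 * \<dots> = 72 * (3 * y - 4 * y^3)"
      unfolding w d2
      by (simp add: power2_eq_square power3_eq_cube algebra_simps q2 yy red)
    finally show ?thesis by simp
  qed
  have c2: "w0 * (x * y\<^sup>2) + w1 * (a1 * b1\<^sup>2) + w2 * (a2 * b2\<^sup>2) = 0"
  proof -
    have "9*8*(w0 * (x * y\<^sup>2) + w1 * (a1 * b1\<^sup>2) + w2 * (a2 * b2\<^sup>2)) 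
      = 8*(9*w0) * (x * y\<^sup>2) + (9*w1) * ((2*a1) * (2*b1)^2) + (9*w2) * ((2*a2) * (2*b2)^2)"
      by (simp add: power_mult_distrib algebra_simps)
    also have "\<dots> = 0"
      unfolding w d2
      by (simp add: power2_eq_square power3_eq_cube algebra_simps q2 yy red)
    finally show ?thesis by simp
  qed
  have c3: "w0 * y^3 + w1 * b1^3 + w2 * b2^3 = 0"
  proof -
    have "9*8*(w0 * y^3 + w1 * b1^3 + w2 * b2^3) = 8*(9*w0) * y^3 + (9*w1) * (2*b1)^3 + (9*w2) * (2*b2)^3"
      by (simp add: power_mult_distrib algebra_simps)
    also have "\<dots> = 0"
      unfolding w d2
      by (simp add: power2_eq_square power3_eq_cube algebra_simps q2 yy red)
    finally show ?thesis by simp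
  qed
  have "w0 * P x y + w1 * P a1 b1 + w2 * P a2 b2 =
     (w0 * x^3 + w1 * a1^3 + w2 * a2^3) * p0
     + 3 * (w0 * (x\<^sup>2 * y) + w1 * (a1\<^sup>2 * b1) + w2 * (a2\<^sup>2 * b2)) * p1
     + 3 * (w0 * (x * y\<^sup>2) + w1 * (a1 * b1\<^sup>2) + w2 * (a2 * b2\<^sup>2)) * p2
     + (w0 * y^3 + w1 * b1^3 + w2 * b2^3) * p3"
    unfolding P_def by (simp add: algebra_simps)
  also have "\<dots> = (4 * x^3 - 3 * x) * p0 + (3 * y - 4 * y^3) * p1"
    unfolding c0 c1 c2 c3 by simp
  finally show "(4 * x^3 - 3 * x) * p0 + (3 * y - 4 * y^3) * p1 =
      w0 * P x y + w1 * P (- x / 2 - q * y / 2) (- y / 2 + q * x / 2)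
        + w2 * P (- x / 2 + q * y / 2) (- y / 2 - q * x / 2)"
    unfolding d by simp
qed


text \<open>Trisecting the angle of (a, b) does this. It brings the coefficients of an arbitrary
  unit vector into the form in which the quadrature rule produces them.\<close>

lemma triple_angle_parametrization:
  fixes a b :: real
  assumes "a\<^sup>2 + b\<^sup>2 = 1"
  obtains x y where "x\<^sup>2 + y\<^sup>2 = 1" "a = 4 * x^3 - 3 * x" "b = 3 * y - 4 * y^3"
proof -
  obtain \<theta> where \<theta>: "a = cos \<theta>" "b = sin \<theta>"
    using sincos_total_2pi assms by metis
  have "cos \<theta> = 4 * cos (\<theta>/3)^3 - 3 * cos (\<theta>/3)"
    using cos_treble_cos[of "\<theta>/3"] by simp
  moreover have "sin \<theta> = 3 * sin (\<theta>/3) - 4 * sin (\<theta>/3)^3"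
  proof -
    have "sin \<theta> = sin (\<theta>/3 + 2 * (\<theta>/3))" by simp
    also have "\<dots> = sin (\<theta>/3) * (1 - 2 * (sin (\<theta>/3))\<^sup>2) + 2 * sin (\<theta>/3) * (cos (\<theta>/3))\<^sup>2"
      unfolding sin_add cos_double_sin sin_double by (simp add: power2_eq_square)
    also have "\<dots> = 3 * sin (\<theta>/3) - 4 * sin (\<theta>/3)^3"
      unfolding cos_squared_eq by (simp add: power2_eq_square power3_eq_cube algebra_simps)
    finally show ?thesis .
  qed
  ultimately show ?thesis using that[of "cos (\<theta>/3)" "sin (\<theta>/3)"] \<theta> by simp
qed

section \<open>Cubic forms relative to an inner product\<close>

locale inner_form =
  fixes Q :: "'a::real_vector \<Rightarrow> 'a \<Rightarrow> real"
  assumes linear_Q: "linear (\<lambda>u. Q u v)"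
    and sym_Q: "Q u v = Q v u"
    and pos_Q: "u \<noteq> 0 \<Longrightarrow> Q u u > 0"
begin

lemma Q_simps:
  "Q (u + v) w = Q u w + Q v w" "Q w (u + v) = Q w u + Q w v"
  "Q (r *\<^sub>R u) w = r * Q u w" "Q w (r *\<^sub>R u) = r * Q w u"
  "Q (u - v) w = Q u w - Q v w" "Q w (u - v) = Q w u - Q w v"
  "Q 0 w = 0" "Q w 0 = 0"
  using linear_add[OF linear_Q] linear_scale[OF linear_Q] linear_diff[OF linear_Q]
    linear_0[OF linear_Q]
  by (simp_all add: sym_Q[of w])

lemma nonneg_Q: "Q u u \<ge> 0"
  using pos_Q[of u] by (cases "u = 0") (auto simp: Q_simps)

text \<open>One Gram-Schmidt step. The bound on \<open>Q w w\<close> is an inequality because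
  \<open>w = 0\<close> is taken when \<open>v\<close> is a multiple of \<open>u\<close>; in
  dimension one no unit vector orthogonal to \<open>u\<close> exists.\<close>

lemma orthogonal_split:
  assumes "Q u u = 1" "Q v v = 1"
  obtains a b w where "v = a *\<^sub>R u + b *\<^sub>R w" "a\<^sup>2 + b\<^sup>2 = 1" "Q u w = 0" "Q w w \<le> 1"
proof -
  define a where "a = Q u v"
  define r where "r = v - a *\<^sub>R u"
  have rr: "Q r r = 1 - a\<^sup>2"
    using assms by (simp add: r_def Q_simps a_def sym_Q[of v u] power2_eq_square)
  have ur: "Q u r = 0" using assms by (simp add: r_def Q_simps a_def)
  show ?thesis
  proof (cases "r = 0")
    case True
    then have "a\<^sup>2 = 1" using rr by (simp add: Q_simps)
    then show ?thesis using that[of a 0 0] True by (simp add: r_def Q_simps)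
  next
    case False
    define b where "b = sqrt (Q r r)"
    have b: "b > 0" "b * b = Q r r" using pos_Q[OF False] by (auto simp: b_def)
    show ?thesis
    proof (rule that[of a b "(1 / b) *\<^sub>R r"])
      show "v = a *\<^sub>R u + b *\<^sub>R (1 / b) *\<^sub>R r" using b by (simp add: r_def)
      show "a\<^sup>2 + b\<^sup>2 = 1" using b rr by (simp add: power2_eq_square)
      show "Q u ((1 / b) *\<^sub>R r) = 0" by (simp add: Q_simps ur)
      show "Q ((1 / b) *\<^sub>R r) ((1 / b) *\<^sub>R r) \<le> 1" using b by (simp add: Q_simps flip: b(2))
    qed
  qed
qed

text \<open>For unit vectors, splitting \<open>v\<close> along \<open>u\<close> and an orthogonal
  \<open>w\<close> makes \<open>T u u v\<close> a value of the quadrature functional, hence a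
  weighted mean of diagonal values at points of norm at most 1, each bounded by \<open>M\<close>.
  Homogeneity of degree 2 in \<open>u\<close> and 1 in \<open>v\<close> gives the rest.\<close>

lemma symmetric_trilinear_bound:
  fixes T :: "'a \<Rightarrow> 'a \<Rightarrow> 'a \<Rightarrow> real"
  assumes linT: "\<And>v w. linear (\<lambda>u. T u v w)"
    and T12: "\<And>u v w. T u v w = T v u w" and T23: "\<And>u v w. T u v w = T u w v"
    and diag: "\<And>h. \<bar>T h h h\<bar> \<le> M * Q h h powr (3/2)"
  shows "\<bar>T u u v\<bar> \<le> M * Q u u * sqrt (Q v v)"
proof -
  have T1: "T (x + y) v w = T x v w + T y v w" "T (r *\<^sub>R x) v w = r * T x v w" "T 0 v w = 0" for x y v w r
    using linear_add[OF linT] linear_scale[OF linT] linear_0[OF linT] by auto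
  have T2: "T v (x + y) w = T v x w + T v y w" "T v (r *\<^sub>R x) w = r * T v x w" "T v 0 w = 0" for x y v w r
    using T1 T12 by metis+
  have T3: "T v w (x + y) = T v w x + T v w y" "T v w (r *\<^sub>R x) = r * T v w x" "T v w 0 = 0" for x y v w r
    using T2 T23 by metis+
  note T_simps = T1 T2 T3
  have unit: "\<bar>T u u v\<bar> \<le> M" if u: "Q u u = 1" and v: "Q v v = 1" for u v
  proof -
    have M: "M \<ge> 0" using diag[of u] u by simp
    obtain a b w where v: "v = a *\<^sub>R u + b *\<^sub>R w" and ab: "a\<^sup>2 + b\<^sup>2 = 1" and uw: "Q u w = 0" "Q w w \<le> 1"
      using orthogonal_split[OF u v] .
    obtain x y where xy: "x\<^sup>2 + y\<^sup>2 = 1" "a = 4 * x^3 - 3 * x" "b = 3 * y - 4 * y^3"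
      using triple_angle_parametrization[OF ab] .
    define q where "q = sqrt (3::real)"
    have q: "q\<^sup>2 = 3" by (simp add: q_def)
    define P where "P = (\<lambda>c s. c^3 * T u u u + 3 * c\<^sup>2 * s * T u u w + 3 * c * s\<^sup>2 * T u w w + s^3 * T w w w)"
    have P: "\<bar>P c s\<bar> \<le> M" if "c\<^sup>2 + s\<^sup>2 = 1" for c s
    proof -
      let ?h = "c *\<^sub>R u + s *\<^sub>R w"
      have "T ?h ?h ?h = P c s"
        by (simp add: T_simps P_def T12[of w u] T23[of w w u] T23[of u w u] power2_eq_square power3_eq_cube algebra_simps)
      moreover have "Q ?h ?h \<le> 1"
      proof -
        have "Q ?h ?h = c\<^sup>2 + s\<^sup>2 * Q w w"
          using u uw by (simp add: Q_simps sym_Q[of w u] power2_eq_square algebra_simps)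
        also have "\<dots> \<le> c\<^sup>2 + s\<^sup>2 * 1" by (intro add_left_mono mult_left_mono uw) auto
        finally show ?thesis using that by simp
      qed
      then have "Q ?h ?h powr (3/2) \<le> 1 powr (3/2)"
        by (intro powr_mono2 nonneg_Q) auto
      then have "M * Q ?h ?h powr (3/2) \<le> M" using M by (simp add: mult_left_le)
      ultimately show ?thesis using diag[of ?h] by simp
    qed
    define w0 w1 w2 where "w0 = ((1 + 2 * (x\<^sup>2 - y\<^sup>2)) / 3)\<^sup>2"
      and "w1 = ((1 - (x\<^sup>2 - y\<^sup>2) + q * (2 * x * y)) / 3)\<^sup>2"
      and "w2 = ((1 - (x\<^sup>2 - y\<^sup>2) - q * (2 * x * y)) / 3)\<^sup>2"
    have nonneg: "w0 \<ge> 0" "w1 \<ge> 0" "w2 \<ge> 0" by (simp_all add: w0_def w1_def w2_def)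
    have "T u u v = a * T u u u + b * T u u w" by (simp add: v T_simps)
    also have "\<dots> = w0 * P x y + w1 * P (- x / 2 - q * y / 2) (- y / 2 + q * x / 2)
        + w2 * P (- x / 2 + q * y / 2) (- y / 2 - q * x / 2)"
      unfolding xy(2,3) P_def w0_def w1_def w2_def
      by (rule cubic_form_quadrature(2)[OF xy(1) q])
    also have "\<bar>\<dots>\<bar> \<le> w0 * M + w1 * M + w2 * M"
    proof -
      have n: "(- x / 2 - q * y / 2)\<^sup>2 + (- y / 2 + q * x / 2)\<^sup>2 = 1" 
        "(- x / 2 + q * y / 2)\<^sup>2 + (- y / 2 - q * x / 2)\<^sup>2 = 1"
      proof -
        have "(q * x)\<^sup>2 + (q*y)\<^sup>2 = 3" using q xy(1) by (simp add: power_mult_distrib flip: distrib_left)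
        then show "(- x / 2 - q * y / 2)\<^sup>2 + (- y / 2 + q * x / 2)\<^sup>2 = 1" 
          "(- x / 2 + q * y / 2)\<^sup>2 + (- y / 2 - q * x / 2)\<^sup>2 = 1"
          using xy(1) by (simp_all add: power2_eq_square field_simps)
      qed
      have *: "\<bar>r * p\<bar> \<le> r * M" if "\<bar>p\<bar> \<le> M" "0 \<le> r" for r p
        using that by (simp add: abs_mult mult_left_mono)
      show ?thesis
        using *[OF P[OF xy(1)] nonneg(1)] *[OF P[OF n(1)] nonneg(2)] *[OF P[OF n(2)] nonneg(3)]
        by linarith
    qed
    also have "\<dots> = (w0 + w1 + w2) * M" by (simp add: algebra_simps)
    also have "w0 + w1 + w2 = 1"
      unfolding w0_def w1_def w2_def by (rule cubic_form_quadrature(1)[OF xy(1) q])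
    finally show ?thesis by simp
  qed
  show ?thesis
  proof (cases "u = 0 \<or> v = 0")
    case True
    then show ?thesis by (auto simp: T_simps Q_simps)
  next
    case False
    define r s where "r = sqrt (Q u u)" and "s = sqrt (Q v v)"
    have rs: "r > 0" "s > 0" "r * r = Q u u" "s * s = Q v v"
      using False pos_Q by (simp_all add: r_def s_def nonneg_Q)
    have "Q ((1/r) *\<^sub>R u) ((1/r) *\<^sub>R u) = 1" "Q ((1/s) *\<^sub>R v) ((1/s) *\<^sub>R v) = 1"
      using rs by (simp_all add: Q_simps flip: rs(3,4))
    from unit[OF this] have "\<bar>T u u v / (r * r * s)\<bar> \<le> M" by (simp add: T_simps mult.commute)
    then have "\<bar>T u u v\<bar> \<le> M * (r * r) * s" using rs(1,2) by (simp add: abs_mult pos_divide_le_eq mult.assoc)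
    then show ?thesis unfolding rs(3) s_def .
  qed
qed

end

section \<open>Frank--Wolfe for a strongly convex quadratic\<close>

text \<open>Here \<open>h\<close> is the primal gap and \<open>V\<close> the Frank-Wolfe gap. While the run lasts, \<open>h\<close> decays
  like \<open>2 K / (t + 1)\<close>; in addition each step of the second half decreases it by at least
  \<open>\<eta>\<^sup>2 / (2 K)\<close>, and the two bounds are compatible only for \<open>N\<close> of order \<open>K / \<eta>\<close>.\<close>

lemma FW_sequence_bound:
  fixes h V :: "nat \<Rightarrow> real"
  assumes K: "0 < \<eta>" "\<eta> \<le> K"
    and h: "\<And>t. 0 \<le> h t" "\<And>t. t < N \<Longrightarrow> h t \<le> V t"
    and V: "\<And>t. t < N \<Longrightarrow> \<eta> < V t"
    and step: "\<And>t. t < N \<Longrightarrow> h (Suc t) \<le> h t - min (V t / 2) ((V t)\<^sup>2 / (2 * K))"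
    and h1: "0 < N \<Longrightarrow> h 1 \<le> K"
  shows "real N \<le> 4 * K / \<eta>"
proof (cases "N \<le> 1")
  case True
  have "\<eta> \<le> 4 * K" using K by simp
  then have "1 \<le> 4 * K / \<eta>" using K by simp
  then show ?thesis using True by simp
next
  case False
  have rate: "h (Suc t) \<le> 2 * K / (real t + 2)" if "Suc t \<le> N" for t
    using that
  proof (induction t)
    case 0
    then show ?case using h1 K by simp
  next
    case (Suc t)
    let ?b = "2 * K / (real t + 2)"
    have hb: "h (Suc t) \<le> ?b" using Suc by simp
    have bK: "?b \<le> K" using K by (simp add: field_simps)
    have h0: "0 \<le> h (Suc t)" by (rule h)
    have hV: "h (Suc t) \<le> V (Suc t)" using h Suc.prems by simp
    \<comment> \<open>Both arguments of the minimum dominate this quantity: the second because h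
      \<le> V, the first because moreover h \<le> K.\<close>
    have "(h (Suc t))\<^sup>2 / (2 * K) \<le> min (V (Suc t) / 2) ((V (Suc t))\<^sup>2 / (2 * K))"
    proof -
      have "(h (Suc t))\<^sup>2 / (2 * K) \<le> (V (Suc t))\<^sup>2 / (2 * K)"
        using h0 hV K by (intro divide_right_mono power_mono) auto
      moreover have "(h (Suc t))\<^sup>2 \<le> V (Suc t) * K"
        unfolding power2_eq_square using h0 hV hb bK by (intro mult_mono) auto
      then have "(h (Suc t))\<^sup>2 / (2 * K) \<le> V (Suc t) / 2"
        using K by (simp add: field_simps)
      ultimately show ?thesis by simp
    qed
    then have "h (Suc (Suc t)) \<le> h (Suc t) - (h (Suc t))\<^sup>2 / (2 * K)"
      using step[of "Suc t"] Suc.prems by linarith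
    also have "\<dots> \<le> ?b - ?b\<^sup>2 / (2 * K)"
    proof -
      \<comment> \<open>This is monotonicity of y \<mapsto> y - y^2 / (2 K) up to K, which lets the
        induction bound on \<open>h\<close> be inserted into the recursion.\<close>
      have "(b - y) * (b + y) / (2 * K) \<le> b - y" if "y \<le> b" "b \<le> K" for b y
        using mult_left_mono[of "b + y" "2 * K" "b - y"] that K by (simp add: pos_divide_le_eq)
      from this[OF hb bK] have "(?b\<^sup>2 - (h (Suc t))\<^sup>2) / (2 * K) \<le> ?b - h (Suc t)"
        by (simp only: power2_eq_square square_diff_square_factored mult.commute)
      then show ?thesis by (simp add: diff_divide_distrib)
    qed
    also have "\<dots> = 2 * K * ((real t + 1) / (real t + 2)\<^sup>2)"
    proof -
      have "2 * K / r - (2 * K / r)\<^sup>2 / (2 * K) = 2 * K * ((r - 1) / r\<^sup>2)" if "r > 0" for r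
        using K that by (simp add: power2_eq_square field_simps)
      from this[of "real t + 2"] show ?thesis by simp
    qed
    also have "\<dots> \<le> 2 * K * (1 / (real t + 3))"
    proof (rule mult_left_mono)
      have "(real t + 1) * (real t + 3) \<le> (real t + 2)\<^sup>2" by (simp add: power2_eq_square algebra_simps)
      then show "(real t + 1) / (real t + 2)\<^sup>2 \<le> 1 / (real t + 3)"
        by (simp add: divide_le_eq pos_le_divide_eq add_pos_nonneg)
    qed (use K in simp)
    finally show ?case by (simp add: add.commute)
  qed
  define d where "d = N div 2"
  have d: "d \<ge> 1" "2 * d \<le> N" "N \<le> 2 * d + 1" using False by (auto simp: d_def)
  have decrease: "h (N - d + j) \<le> h (N - d) - real j * (\<eta>\<^sup>2 / (2 * K))" if "j \<le> d" for j
    using that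
  proof (induction j)
    case (Suc j)
    let ?t = "N - d + j"
    have t: "?t < N" using Suc.prems d by simp
    have "\<eta>\<^sup>2 / (2 * K) \<le> min (V ?t / 2) ((V ?t)\<^sup>2 / (2 * K))"
    proof -
      have "\<eta>\<^sup>2 / (2 * K) \<le> (V ?t)\<^sup>2 / (2 * K)"
        using V[OF t] K by (intro divide_right_mono power_mono) auto
      moreover have "\<eta>\<^sup>2 \<le> V ?t * K"
        unfolding power2_eq_square using V[OF t] K by (intro mult_mono) auto
      then have "\<eta>\<^sup>2 / (2 * K) \<le> V ?t / 2"
        using K by (simp add: field_simps)
      ultimately show ?thesis by simp
    qed
    then have "h (Suc ?t) \<le> h ?t - \<eta>\<^sup>2 / (2 * K)" using step[OF t] by linarith
    then show ?case using Suc by (simp add: distrib_right add_divide_distrib)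
  qed simp
  have "h N \<le> h (N - d) - real d * (\<eta>\<^sup>2 / (2 * K))"
    using decrease[of d] d by simp
  moreover have "h (N - d) \<le> 2 * K / (real (N - d) + 1)"
  proof -
    obtain t where t: "N - d = Suc t" using d by (cases "N - d") auto
    then have "Suc t \<le> N" by linarith
    from rate[OF this] show ?thesis by (simp add: t add.commute)
  qed
  ultimately have "real d * (\<eta>\<^sup>2 / (2 * K)) \<le> 2 * K / (real (N - d) + 1)"
    using h(1)[of N] by simp
  then have "real d * (real (N - d) + 1) * \<eta>\<^sup>2 \<le> (2 * K)\<^sup>2"
    using K by (simp add: field_simps power2_eq_square)
  \<comment> \<open>Splitting in the middle maximizes the product up to rounding. For odd
    \<open>N\<close> the estimate uses \<open>d \<ge> 1\<close>, which is why
    \<open>N \<le> 1\<close> was treated apart. The square root of the resulting inequality is the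
    origin of the constant 4.\<close>
  moreover have "(real N)\<^sup>2 / 4 \<le> real d * (real (N - d) + 1)"
  proof -
    have "N = 2 * d \<or> N = 2 * d + 1" using d by arith
    then show ?thesis
      using d(1) by (auto simp: power2_eq_square field_simps)
  qed
  ultimately have "(real N)\<^sup>2 / 4 * \<eta>\<^sup>2 \<le> (2 * K)\<^sup>2"
    by (meson mult_right_mono order_trans zero_le_power2)
  then have "(real N * \<eta>)\<^sup>2 \<le> (4 * K)\<^sup>2" by (simp add: power_mult_distrib)
  then have "real N * \<eta> \<le> 4 * K" by (rule power2_le_imp_le) (use K in simp)
  then show ?thesis using K by (simp add: field_simps)
qed

section \<open>Termination and cost of a Frank-Wolfe run\<close>

lemma while_option_least:
  assumes "\<exists>k. \<not> b ((c ^^ k) s)"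
  obtains k where "while_option b c s = Some ((c ^^ k) s)" "\<not> b ((c ^^ k) s)"
    "\<And>j. j < k \<Longrightarrow> b ((c ^^ j) s)"
proof -
  define k where "k = (LEAST k. \<not> b ((c ^^ k) s))"
  have "while_option b c s = Some ((c ^^ k) s)"
    using assms by (simp add: while_option_def k_def)
  moreover have "\<not> b ((c ^^ k) s)"
    unfolding k_def using assms by (rule LeastI_ex)
  moreover have "b ((c ^^ j) s)" if "j < k" for j
    using not_less_Least[OF that[unfolded k_def]] by simp
  ultimately show ?thesis using that by blast
qed

text \<open>The run minimizes the quadratic model with gradient \<open>q\<close> at
  \<open>u0\<close> and Hessian \<open>H\<close>, so the recursion for primal and Frank-Wolfe gaps
  applies. The extra 1 in the count is the oracle call of the successful stopping test.\<close>

lemma FW_terminates: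
  fixes X :: "(real^'p) set" and q u0 :: "real^'p" and H :: "real^'p^'p"
  assumes X: "convex X" "compact X" "u0 \<in> X"
    and lmo: "\<And>t. is_LMO X (lmo t)"
    and sym: "\<And>u v. u \<bullet> (H *v v) = v \<bullet> (H *v u)"
    and pos: "\<And>u. u \<noteq> 0 \<Longrightarrow> 0 < u \<bullet> (H *v u)"
    and curv: "\<And>u v. u \<in> X \<Longrightarrow> v \<in> X \<Longrightarrow> (v - u) \<bullet> (H *v (v - u)) \<le> K"
    and K: "0 < \<eta>" "\<eta> \<le> K"
  obtains z n where "FW lmo q H u0 \<eta> = Some (z, n)" "z \<in> X" "real n \<le> 4 * K / \<eta> + 1"
    "\<And>s. s \<in> X \<Longrightarrow> (q + H *v (z - u0)) \<bullet> (z - s) \<le> \<eta>"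
proof -
  define b where "b = (\<lambda>(t, u). FW_gap lmo q H u0 t u > \<eta>)"
  define c where "c = (\<lambda>(t, u). (Suc t, FW_step lmo q H u0 t u))"
  define U where "U = (\<lambda>t. snd ((c ^^ t) (0, u0)))"
  have iter: "(c ^^ t) (0, u0) = (t, U t)" for t
  proof -
    have "fst ((c ^^ t) (0, u0)) = t" by (induction t) (auto simp: c_def split: prod.splits)
    then show ?thesis by (simp add: U_def prod_eq_iff)
  qed
  have U0: "U 0 = u0" by (simp add: U_def)
  have USuc: "U (Suc t) = FW_step lmo q H u0 t (U t)" for t
    using iter[of "Suc t"] iter[of t] by (simp add: c_def)
  define g where "g = FW_grad q H u0"
  define v where "v = (\<lambda>t. lmo t (g (U t)))"
  define V where "V = (\<lambda>t. g (U t) \<bullet> (U t - v t))"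
  define \<delta> where "\<delta> = (\<lambda>t. (v t - U t) \<bullet> (H *v (v t - U t)))"
  define \<tau> where "\<tau> = (\<lambda>t. min 1 (V t / \<delta> t))"
  have gap: "FW_gap lmo q H u0 t (U t) = V t" for t
    by (simp add: FW_gap_def V_def v_def g_def Let_def)
  have USuc': "U (Suc t) = U t + \<tau> t *\<^sub>R (v t - U t)" for t
    unfolding USuc FW_step_def Let_def gap \<tau>_def \<delta>_def v_def g_def by (simp add: algebra_simps)
  have v: "v t \<in> X" "s \<in> X \<Longrightarrow> g (U t) \<bullet> v t \<le> g (U t) \<bullet> s" for t s
    using lmo[of t] by (auto simp: is_LMO_def is_arg_min_linorder v_def)
  have psd: "0 \<le> u \<bullet> (H *v u)" for u
    using pos[of u] by (cases "u = 0") auto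
  have V0: "0 \<le> V t" if "U t \<in> X" for t
    using v(2)[OF that, of t] by (simp add: V_def inner_diff_right)
  have UX: "U t \<in> X" for t
  proof (induction t)
    case 0
    then show ?case using X U0 by simp
  next
    case (Suc t)
    \<comment> \<open>The sequence is also defined after the stopping test has succeeded, where
      \<open>\<delta> t\<close> may vanish; then division by zero yields 0 and the iterate does not
      move.\<close>
    have "0 \<le> \<tau> t" "\<tau> t \<le> 1" using V0[OF Suc] psd by (auto simp: \<tau>_def \<delta>_def)
    moreover have "U (Suc t) = (1 - \<tau> t) *\<^sub>R U t + \<tau> t *\<^sub>R v t"
      unfolding USuc' by (simp add: algebra_simps)
    ultimately show ?case using convexD_alt[OF X(1) Suc v(1)] by simp
  qed
  define \<psi> where "\<psi> = (\<lambda>u. q \<bullet> (u - u0) + (u - u0) \<bullet> (H *v (u - u0)) / 2)"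
  have \<psi>_add: "\<psi> (u + d) = \<psi> u + g u \<bullet> d + d \<bullet> (H *v d) / 2" for u d
  proof -
    have *: "u + d - u0 = (u - u0) + d" by simp
    show ?thesis
      using sym[of "u - u0" d] 
      by (simp only: \<psi>_def g_def FW_grad_def *) (simp add: \<psi>_def g_def FW_grad_def matrix_vector_right_distrib inner_add inner_commute[of "H *v (u - u0)" d] add_divide_distrib)
  qed
  have "continuous_on X (\<lambda>u. H *v (u - u0))"
    by (rule linear_continuous_on_compose[of X "\<lambda>u. u - u0" "(*v) H"])
      (auto intro!: continuous_intros)
  then have "continuous_on X \<psi>"
    unfolding \<psi>_def by (intro continuous_intros) auto
  then obtain m where m: "m \<in> X" "\<And>u. u \<in> X \<Longrightarrow> \<psi> m \<le> \<psi> u"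
    using continuous_attains_inf[OF X(2)] X(3) by blast
  define h where "h = (\<lambda>t. \<psi> (U t) - \<psi> m)"
  have h0: "0 \<le> h t" for t using m(2)[OF UX] by (simp add: h_def)
  have hV: "h t \<le> V t" for t
  proof -
    have "\<psi> (U t + (m - U t)) \<ge> \<psi> (U t) + g (U t) \<bullet> (m - U t)"
      unfolding \<psi>_add using psd by simp
    moreover have "g (U t) \<bullet> (m - U t) \<ge> - V t"
      using v(2)[OF m(1), of t] by (simp add: V_def inner_diff_right)
    ultimately show ?thesis by (simp add: h_def)
  qed
  \<comment> \<open>The second claim supplies the start of the O(1 / t) rate: a single step brings
    the primal gap below \<open>K\<close>, however large it was at \<open>u0\<close>.\<close>
  have step: "h (Suc t) \<le> h t - min (V t / 2) ((V t)\<^sup>2 / (2 * K))" 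
    and hK: "h (Suc t) \<le> K" if Vt: "\<eta> < V t" for t
  proof -
    have Vpos: "V t > 0" using Vt K by simp
    then have "v t - U t \<noteq> 0" by (auto simp: V_def)
    then have \<delta>pos: "\<delta> t > 0" unfolding \<delta>_def by (rule pos)
    have \<delta>K: "\<delta> t \<le> K" unfolding \<delta>_def by (intro curv UX v)
    \<comment> \<open>The step length minimizes this expression over [0, 1]; the cases below are a
      clipped and an unclipped minimizer.\<close>
    have eq: "h (Suc t) = h t - \<tau> t * V t + (\<tau> t)\<^sup>2 * \<delta> t / 2"
      unfolding h_def USuc' \<psi>_add
      by (simp add: V_def \<delta>_def inner_diff_right matrix_vector_mult_scaleR power2_eq_square algebra_simps)
    have "h (Suc t) \<le> h t - min (V t / 2) ((V t)\<^sup>2 / (2 * K)) \<and> h (Suc t) \<le> K"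
    proof (cases "\<delta> t \<le> V t")
      case True
      then have "\<tau> t = 1" using \<delta>pos by (simp add: \<tau>_def)
      then have "h (Suc t) = h t - V t + \<delta> t / 2" using eq by simp
      then show ?thesis using True hV[of t] \<delta>K \<delta>pos by auto
    next
      case False
      then have "\<tau> t = V t / \<delta> t" using \<delta>pos by (simp add: \<tau>_def)
      then have "h (Suc t) = h t - (V t)\<^sup>2 / (2 * \<delta> t)"
        unfolding eq using \<delta>pos by (simp add: power2_eq_square)
      moreover have "(V t)\<^sup>2 / (2 * K) \<le> (V t)\<^sup>2 / (2 * \<delta> t)"
        using \<delta>K \<delta>pos by (intro divide_left_mono) auto
      moreover have "(V t)\<^sup>2 / (2 * \<delta> t) \<ge> 0" using \<delta>pos by simp
      ultimately show ?thesis using hV[of t] False \<delta>K by auto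
    qed
    then show "h (Suc t) \<le> h t - min (V t / 2) ((V t)\<^sup>2 / (2 * K))" "h (Suc t) \<le> K" by auto
  qed
  have b_iter: "b ((c ^^ t) (0, u0)) \<longleftrightarrow> \<eta> < V t" for t
    unfolding iter by (simp add: b_def gap)
  \<comment> \<open>This serves twice: for all \<open>N\<close> at once it contradicts an infinite
    run, and at the first stopping index it counts the steps.\<close>
  have bound: "real N \<le> 4 * K / \<eta>" if "\<And>t. t < N \<Longrightarrow> \<eta> < V t" for N
    using that hK[of 0] by (intro FW_sequence_bound[where h = h and V = V] K h0 hV step) auto
  have "\<exists>k. \<not> b ((c ^^ k) (0, u0))"
  proof (rule ccontr)
    assume "\<not> ?thesis"
    then have "real N \<le> 4 * K / \<eta>" for N using bound b_iter by blast
    then show False using reals_Archimedean2[of "4 * K / \<eta>"] by (meson not_less)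
  qed
  then obtain k where k: "while_option b c (0, u0) = Some ((c ^^ k) (0, u0))"
    "\<not> b ((c ^^ k) (0, u0))" "\<And>j. j < k \<Longrightarrow> b ((c ^^ j) (0, u0))"
    using while_option_least by metis
  show ?thesis
  proof (rule that[of "U k" "Suc k"])
    show "FW lmo q H u0 \<eta> = Some (U k, Suc k)"
      using k(1) iter[of k] by (simp add: FW_def b_def c_def)
    show "U k \<in> X" by (rule UX)
    show "real (Suc k) \<le> 4 * K / \<eta> + 1" using bound[of k] k(3) b_iter by simp
    fix s assume "s \<in> X"
    then have "g (U k) \<bullet> (U k - s) \<le> V k" using v(2)[of s k] by (simp add: V_def inner_diff_right)
    also have "\<dots> \<le> \<eta>" using k(2) b_iter by simp
    finally show "(q + H *v (U k - u0)) \<bullet> (U k - s) \<le> \<eta>" by (simp add: g_def FW_grad_def)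
  qed
qed

section \<open>Directional derivatives\<close>

text \<open>The direction comes first so that \<open>dir_deriv h F\<close> is a function of the
  point again and can be differentiated further, in step with the recursion of
  \<open>C_k_on\<close>.\<close>

definition dir_deriv :: "'a::real_normed_vector \<Rightarrow> ('a \<Rightarrow> 'b::real_normed_vector) \<Rightarrow> 'a \<Rightarrow> 'b" where
  "dir_deriv h F x = frechet_derivative F (at x) h"

lemma C_k_on_Suc_dir_deriv:
  "C_k_on (Suc n) F S \<longleftrightarrow> (\<forall>x\<in>S. F differentiable (at x)) \<and> (\<forall>h. C_k_on n (dir_deriv h F) S)"
  by (simp add: dir_deriv_def[abs_def])

lemma C_k_on_SucD: "C_k_on (Suc n) F S \<Longrightarrow> C_k_on n F S"
proof (induction n arbitrary: F)
  case 0
  then show ?case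
    by (auto intro!: continuous_at_imp_continuous_on differentiable_imp_continuous_within)
next
  case (Suc n)
  then show ?case unfolding C_k_on_Suc_dir_deriv[of "Suc n"] C_k_on_Suc_dir_deriv[of n F] by blast
qed

lemma has_derivative_dir_deriv:
  "F differentiable (at x) \<Longrightarrow> (F has_derivative (\<lambda>h. dir_deriv h F x)) (at x)"
  using frechet_derivative_works[of F "at x"] by (simp add: dir_deriv_def)

lemma dir_deriv_eqI: "(F has_derivative F') (at x) \<Longrightarrow> dir_deriv h F x = F' h"
  by (metis frechet_derivative_at dir_deriv_def)

lemma linear_dir_deriv: "F differentiable (at x) \<Longrightarrow> linear (\<lambda>h. dir_deriv h F x)"
  unfolding dir_deriv_def by (rule linear_frechet_derivative)

lemma dir_deriv_cong:
  assumes "F differentiable (at x)" "open S" "x \<in> S" "\<And>y. y \<in> S \<Longrightarrow> F y = G y"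
  shows "dir_deriv h F x = dir_deriv h G x"
  using frechet_derivative_transform_within_open[OF assms] by (simp add: dir_deriv_def)

text \<open>Linearity is claimed in the direction of the inner derivative. The inner identities must
  hold on a neighbourhood before they can be differentiated, hence the open set.\<close>

lemma linear_dir_deriv2:
  assumes S: "open S" "x \<in> S" and F: "C_k_on 2 F S"
  shows "linear (\<lambda>h. dir_deriv k (dir_deriv h F) x)"
proof -
  have F': "F differentiable (at y)" "dir_deriv h F differentiable (at y)" if "y \<in> S" for h y
    using F that by (auto simp: numeral_2_eq_2 C_k_on_Suc_dir_deriv simp del: C_k_on.simps(2))
  note L = linear_dir_deriv[OF F'(1)]
  have D: "(dir_deriv h F has_derivative (\<lambda>k. dir_deriv k (dir_deriv h F) x)) (at x)" for h
    using F'(2)[OF S(2)] by (rule has_derivative_dir_deriv)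
  show ?thesis
  proof (rule linearI)
    fix h h'
    have "dir_deriv k (dir_deriv (h + h') F) x = dir_deriv k (\<lambda>y. dir_deriv h F y + dir_deriv h' F y) x"
      by (rule dir_deriv_cong[OF F'(2)[OF S(2)] S]) (use linear_add[OF L] in blast)
    also have "\<dots> = dir_deriv k (dir_deriv h F) x + dir_deriv k (dir_deriv h' F) x"
      by (rule dir_deriv_eqI[OF has_derivative_add[OF D D]])
    finally show "dir_deriv k (dir_deriv (h + h') F) x = dir_deriv k (dir_deriv h F) x + dir_deriv k (dir_deriv h' F) x" .
  next
    fix r h
    have "dir_deriv k (dir_deriv (r *\<^sub>R h) F) x = dir_deriv k (\<lambda>y. r *\<^sub>R dir_deriv h F y) x"
      by (rule dir_deriv_cong[OF F'(2)[OF S(2)] S]) (use linear_scale[OF L] in blast)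
    also have "\<dots> = r *\<^sub>R dir_deriv k (dir_deriv h F) x"
      by (rule dir_deriv_eqI[OF has_derivative_scaleR_right[OF D]])
    finally show "dir_deriv k (dir_deriv (r *\<^sub>R h) F) x = r *\<^sub>R dir_deriv k (dir_deriv h F) x" .
  qed
qed

section \<open>Derivatives along lines and symmetry of second derivatives\<close>

lemma has_real_derivative_along_line:
  fixes F :: "'a::real_normed_vector \<Rightarrow> real"
  assumes "F differentiable (at (x + t *\<^sub>R v))"
  shows "((\<lambda>t. F (x + t *\<^sub>R v)) has_real_derivative dir_deriv v F (x + t *\<^sub>R v)) (at t within A)"
proof -
  have "((\<lambda>t. x + t *\<^sub>R v) has_derivative (\<lambda>t. t *\<^sub>R v)) (at t within A)"
    by (auto intro!: derivative_eq_intros)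
  from has_derivative_compose[OF this has_derivative_dir_deriv[OF assms]]
  have "((\<lambda>t. F (x + t *\<^sub>R v)) has_derivative (\<lambda>s. dir_deriv (s *\<^sub>R v) F (x + t *\<^sub>R v))) (at t within A)" .
  then show ?thesis
    using linear_scale[OF linear_dir_deriv[OF assms]]
    by (simp add: has_field_derivative_def mult_commute_abs)
qed

text \<open>Two applications of the mean value theorem, in direction \<open>h\<close> and then in
  direction \<open>k\<close>, express the quotient as the mixed derivative at an intermediate point;
  continuity of that derivative finishes. The quotient needs only values of \<open>F\<close>, so
  both symmetry and convexity can be read off from it.\<close>

lemma second_difference_tendsto:
  fixes F :: "'a::real_normed_vector \<Rightarrow> real"
  assumes S: "open S" "x \<in> S" and F: "C_k_on 2 F S"
  shows "((\<lambda>t. (F (x + t *\<^sub>R h + t *\<^sub>R k) - F (x + t *\<^sub>R h) - F (x + t *\<^sub>R k) + F x) / t\<^sup>2)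
    \<longlongrightarrow> dir_deriv k (dir_deriv h F) x) (at_right 0)"
proof (rule tendstoI)
  fix e :: real assume "e > 0"
  have F': "F differentiable (at y)" "dir_deriv h F differentiable (at y)" if "y \<in> S" for h y
    using F that by (auto simp: numeral_2_eq_2 C_k_on_Suc_dir_deriv simp del: C_k_on.simps(2))
  have "continuous_on S (dir_deriv k (dir_deriv h F))"
    using F by (simp add: numeral_2_eq_2 dir_deriv_def[abs_def])
  then have "isCont (dir_deriv k (dir_deriv h F)) x"
    using S continuous_on_eq_continuous_at by blast
  then obtain d where d: "d > 0"
    "\<And>y. dist y x < d \<Longrightarrow> dist (dir_deriv k (dir_deriv h F) y) (dir_deriv k (dir_deriv h F) x) < e"
    using \<open>e > 0\<close> unfolding continuous_at_eps_delta by metis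
  obtain d' where d': "d' > 0" "ball x d' \<subseteq> S" using S openE by blast
  \<comment> \<open>This keeps the parallelogram with sides \<open>t *\<^sub>R h\<close> and
    \<open>t *\<^sub>R k\<close> inside both balls; the summand 1 covers
    \<open>h = k = 0\<close>.\<close>
  define r where "r = min d d' / (norm h + norm k + 1)"
  have nn: "norm h + norm k + 1 > 0" by (simp add: add_nonneg_pos)
  have r: "r > 0" using d d' nn by (simp add: r_def)
  show "\<forall>\<^sub>F t in at_right 0. dist ((F (x + t *\<^sub>R h + t *\<^sub>R k) - F (x + t *\<^sub>R h) - F (x + t *\<^sub>R k) + F x) / t\<^sup>2)
         (dir_deriv k (dir_deriv h F) x) < e"
    unfolding eventually_at_right_field
  proof (intro exI[of _ r] conjI r allI impI)
    fix t :: real assume t: "0 < t" "t < r"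
    have near: "dist (x + a *\<^sub>R h + b *\<^sub>R k) x < min d d'" if "0 \<le> a" "a \<le> t" "0 \<le> b" "b \<le> t" for a b
    proof -
      have "dist (x + a *\<^sub>R h + b *\<^sub>R k) x = norm (a *\<^sub>R h + b *\<^sub>R k)"
        by (simp add: dist_norm add.assoc)
      also have "\<dots> \<le> a * norm h + b * norm k"
        using norm_triangle_ineq[of "a *\<^sub>R h" "b *\<^sub>R k"] that by simp
      also have "\<dots> \<le> t * norm h + t * norm k" using that by (intro add_mono mult_right_mono) auto
      also have "\<dots> \<le> t * (norm h + norm k + 1)" using t by (simp add: algebra_simps)
      also have "\<dots> < r * (norm h + norm k + 1)" using t nn by (intro mult_strict_right_mono)
      also have "\<dots> = min d d'" using nn by (simp add: r_def)
      finally show ?thesis .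
    qed
    have inS: "x + a *\<^sub>R h + b *\<^sub>R k \<in> S" if "0 \<le> a" "a \<le> t" "0 \<le> b" "b \<le> t" for a b
      using near[OF that] d'(2) by (auto simp: dist_commute subset_eq)
    define G where "G = (\<lambda>a. F (x + t *\<^sub>R k + a *\<^sub>R h) - F (x + a *\<^sub>R h))"
    have "\<exists>a. 0 < a \<and> a < t \<and> G t - G 0 = (t - 0) * (dir_deriv h F (x + t *\<^sub>R k + a *\<^sub>R h) - dir_deriv h F (x + a *\<^sub>R h))"
    proof (rule MVT2[OF t(1)])
      fix a assume a: "0 \<le> a" "a \<le> t"
      have "x + t *\<^sub>R k + a *\<^sub>R h \<in> S" "x + a *\<^sub>R h \<in> S"
        using inS[of a t] inS[of a 0] a t by (simp_all add: add_ac)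
      then show "DERIV G a :> dir_deriv h F (x + t *\<^sub>R k + a *\<^sub>R h) - dir_deriv h F (x + a *\<^sub>R h)"
        unfolding G_def by (intro DERIV_diff has_real_derivative_along_line F')
    qed
    then obtain a where a: "0 < a" "a < t"
      "G t - G 0 = t * (dir_deriv h F (x + t *\<^sub>R k + a *\<^sub>R h) - dir_deriv h F (x + a *\<^sub>R h))" by auto
    have "\<exists>b. 0 < b \<and> b < t \<and> dir_deriv h F (x + a *\<^sub>R h + t *\<^sub>R k) - dir_deriv h F (x + a *\<^sub>R h + 0 *\<^sub>R k)
        = (t - 0) * dir_deriv k (dir_deriv h F) (x + a *\<^sub>R h + b *\<^sub>R k)"
      using inS a by (intro MVT2[OF t(1)] has_real_derivative_along_line F') auto
    then obtain b where b: "0 < b" "b < t" "dir_deriv h F (x + a *\<^sub>R h + t *\<^sub>R k) - dir_deriv h F (x + a *\<^sub>R h)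
        = t * dir_deriv k (dir_deriv h F) (x + a *\<^sub>R h + b *\<^sub>R k)" by auto
    have "G t - G 0 = t\<^sup>2 * dir_deriv k (dir_deriv h F) (x + a *\<^sub>R h + b *\<^sub>R k)"
      using a(3) b(3) by (simp add: power2_eq_square add_ac)
    moreover have "G t - G 0 = F (x + t *\<^sub>R h + t *\<^sub>R k) - F (x + t *\<^sub>R h) - F (x + t *\<^sub>R k) + F x"
      by (simp add: G_def add_ac)
    ultimately have "(F (x + t *\<^sub>R h + t *\<^sub>R k) - F (x + t *\<^sub>R h) - F (x + t *\<^sub>R k) + F x) / t\<^sup>2
        = dir_deriv k (dir_deriv h F) (x + a *\<^sub>R h + b *\<^sub>R k)"
      using t by simp
    then show "dist ((F (x + t *\<^sub>R h + t *\<^sub>R k) - F (x + t *\<^sub>R h) - F (x + t *\<^sub>R k) + F x) / t\<^sup>2)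
         (dir_deriv k (dir_deriv h F) x) < e"
      using d(2)[of "x + a *\<^sub>R h + b *\<^sub>R k"] near[of a b] a b by simp
  qed
qed

text \<open>The second difference quotient is symmetric in \<open>h\<close> and \<open>k\<close>,
  and its limit is unique.\<close>

lemma dir_deriv_commute:
  fixes F :: "'a::real_normed_vector \<Rightarrow> real"
  assumes S: "open S" "x \<in> S" and F: "C_k_on 2 F S"
  shows "dir_deriv k (dir_deriv h F) x = dir_deriv h (dir_deriv k F) x"
proof -
  have "(\<lambda>t::real. (F (x + t *\<^sub>R h + t *\<^sub>R k) - F (x + t *\<^sub>R h) - F (x + t *\<^sub>R k) + F x) / t\<^sup>2)
      = (\<lambda>t. (F (x + t *\<^sub>R k + t *\<^sub>R h) - F (x + t *\<^sub>R k) - F (x + t *\<^sub>R h) + F x) / t\<^sup>2)"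
  proof
    fix t :: real
    have "F (x + t *\<^sub>R h + t *\<^sub>R k) = F (x + t *\<^sub>R k + t *\<^sub>R h)" by (simp add: add_ac)
    then show "(F (x + t *\<^sub>R h + t *\<^sub>R k) - F (x + t *\<^sub>R h) - F (x + t *\<^sub>R k) + F x) / t\<^sup>2
      = (F (x + t *\<^sub>R k + t *\<^sub>R h) - F (x + t *\<^sub>R k) - F (x + t *\<^sub>R h) + F x) / t\<^sup>2"
      by simp
  qed
  then show ?thesis
    using second_difference_tendsto[OF assms, of h k] second_difference_tendsto[OF assms, of k h]
    by (intro tendsto_unique[of "at_right (0::real)"]) auto
qed

text \<open>As \<open>gradient\<close> is a definite description, uniqueness of the representing
  vector has to be established too. The coordinate sum is the form in which the gradient is visibly
  differentiable.\<close>

lemma gradient_eq: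
  fixes g :: "real^'p \<Rightarrow> real"
  assumes "g differentiable (at x)"
  shows "gradient g x = (\<Sum>i\<in>Basis. dir_deriv i g x *\<^sub>R i)" "h \<bullet> gradient g x = dir_deriv h g x"
proof -
  let ?G = "\<Sum>i\<in>Basis. dir_deriv i g x *\<^sub>R i"
  have *: "h \<bullet> ?G = dir_deriv h g x" for h
  proof -
    have "dir_deriv h g x = dir_deriv (\<Sum>i\<in>Basis. (h \<bullet> i) *\<^sub>R i) g x" by (simp add: euclidean_representation)
    also have "\<dots> = (\<Sum>i\<in>Basis. (h \<bullet> i) * dir_deriv i g x)"
      by (simp add: linear_sum[OF linear_dir_deriv[OF assms]] linear_scale[OF linear_dir_deriv[OF assms]])
    finally show ?thesis by (simp add: inner_sum_right mult.commute)
  qed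
  have G: "GDERIV g x :> ?G"
    unfolding gderiv_def * by (rule has_derivative_dir_deriv[OF assms])
  have "D = ?G" if "GDERIV g x :> D" for D
  proof -
    have "(\<lambda>h. h \<bullet> D) = (\<lambda>h. h \<bullet> ?G)"
      by (rule has_derivative_unique[OF that[unfolded gderiv_def] G[unfolded gderiv_def]])
    then have "h \<bullet> D = h \<bullet> ?G" for h by (rule fun_cong)
    then show ?thesis using vector_eq_ldot[of D ?G] by blast
  qed
  with G show "gradient g x = ?G" unfolding gradient_def by (rule the_equality)
  then show "h \<bullet> gradient g x = dir_deriv h g x" using * by simp
qed

lemma hessian_eq:
  fixes g :: "real^'p \<Rightarrow> real"
  assumes S: "open S" "x \<in> S" and g: "C_k_on 2 g S"
  shows "u \<bullet> (hessian g x *v h) = dir_deriv h (dir_deriv u g) x"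
proof -
  have g': "g differentiable (at y)" "dir_deriv h g differentiable (at y)" if "y \<in> S" for h y
    using g that by (auto simp: numeral_2_eq_2 C_k_on_Suc_dir_deriv simp del: C_k_on.simps(2))
  have "((\<lambda>y. \<Sum>i\<in>Basis. dir_deriv i g y *\<^sub>R i) has_derivative
      (\<lambda>h. \<Sum>i\<in>Basis. dir_deriv h (dir_deriv i g) x *\<^sub>R i)) (at x)"
    by (intro has_derivative_sum has_derivative_scaleR_left has_derivative_dir_deriv g' S)
  then have "(gradient g has_derivative (\<lambda>h. \<Sum>i\<in>Basis. dir_deriv h (dir_deriv i g) x *\<^sub>R i)) (at x)"
    by (rule has_derivative_transform_within_open[OF _ S]) (simp add: gradient_eq(1) g')
  then have "gradient g differentiable (at x)" by (rule differentiableI)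
  then have "(gradient g has_derivative (\<lambda>h. hessian g x *v h)) (at x)"
    unfolding hessian_def by (simp only: jacobian_works)
  then have "((\<lambda>y. u \<bullet> gradient g y) has_derivative (\<lambda>h. u \<bullet> (hessian g x *v h))) (at x)"
    by (rule has_derivative_inner_right)
  then have "(dir_deriv u g has_derivative (\<lambda>h. u \<bullet> (hessian g x *v h))) (at x)"
    by (rule has_derivative_transform_within_open[OF _ S]) (simp add: gradient_eq(2) g')
  then show ?thesis by (simp add: dir_deriv_eqI)
qed

section \<open>Self-concordant functions\<close>

text \<open>Both \<open>b - a\<close> and \<open>b + a\<close> are nondecreasing. This replaces
  integration of a bound that varies along the segment: \<open>b\<close> is an explicit
  antiderivative of it.\<close>

lemma DERIV_abs_diff_le:
  fixes a b :: "real \<Rightarrow> real"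
  assumes "s \<le> t"
    and a: "\<And>u. s \<le> u \<Longrightarrow> u \<le> t \<Longrightarrow> (a has_real_derivative a' u) (at u)"
    and b: "\<And>u. s \<le> u \<Longrightarrow> u \<le> t \<Longrightarrow> (b has_real_derivative b' u) (at u)"
    and le: "\<And>u. s \<le> u \<Longrightarrow> u \<le> t \<Longrightarrow> \<bar>a' u\<bar> \<le> b' u"
  shows "\<bar>a t - a s\<bar> \<le> b t - b s"
proof -
  have "b s - a s \<le> b t - a t"
  proof (rule DERIV_nonneg_imp_nondecreasing[OF assms(1)])
    fix u assume u: "s \<le> u" "u \<le> t"
    show "\<exists>y. ((\<lambda>u. b u - a u) has_real_derivative y) (at u) \<and> 0 \<le> y"
      using DERIV_diff[OF b[OF u] a[OF u]] le[OF u] by (intro exI[of _ "b' u - a' u"]) auto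
  qed
  moreover have "b s + a s \<le> b t + a t"
  proof (rule DERIV_nonneg_imp_nondecreasing[OF assms(1)])
    fix u assume u: "s \<le> u" "u \<le> t"
    show "\<exists>y. ((\<lambda>u. b u + a u) has_real_derivative y) (at u) \<and> 0 \<le> y"
      using DERIV_add[OF b[OF u] a[OF u]] le[OF u] by (intro exI[of _ "b' u + a' u"]) auto
  qed
  ultimately show ?thesis by linarith
qed

locale nondegenerate_self_concordant =
  fixes f :: "real^'p \<Rightarrow> ereal"
  assumes proper: "proper_fun f" and closed: "closed_fun f" and convex: "convex_fun f"
    and C3: "C3_on_domain f" and self_concordant: "standard_self_concordant f"
    and nondegenerate: "x \<in> edom f \<Longrightarrow> invertible (hessian (finite_part f) x)"
begin

abbreviation "g \<equiv> finite_part f"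
abbreviation "S \<equiv> edom f"

definition D2 :: "real^'p \<Rightarrow> real^'p \<Rightarrow> real^'p \<Rightarrow> real" where
  "D2 x u v = dir_deriv v (dir_deriv u g) x"

definition D3 :: "real^'p \<Rightarrow> real^'p \<Rightarrow> real^'p \<Rightarrow> real^'p \<Rightarrow> real" where
  "D3 x u v w = dir_deriv w (dir_deriv v (dir_deriv u g)) x"

lemma open_S: "open S" and C3_g: "C_k_on 3 g S"
  using C3 by (auto simp: C3_on_domain_def)

lemma C2_g: "C_k_on 2 g S"
  using C_k_on_SucD[of 2 g S] C3_g by (simp add: eval_nat_numeral)

lemma C2_dir_deriv: "C_k_on 2 (dir_deriv h g) S"
  using C3_g C_k_on_Suc_dir_deriv[of 2 g S] by (simp add: eval_nat_numeral del: C_k_on.simps)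

lemma differentiable_g:
  assumes "x \<in> S"
  shows "g differentiable (at x)" "dir_deriv h g differentiable (at x)"
    "dir_deriv k (dir_deriv h g) differentiable (at x)"
  using assms C3_g by (auto simp: eval_nat_numeral C_k_on_Suc_dir_deriv simp del: C_k_on.simps(2))

lemma f_eq: "x \<in> S \<Longrightarrow> f x = ereal (g x)"
  using proper by (cases "f x") (auto simp: edom_def proper_fun_def finite_part_def)

lemma D2_eq_hessian: "x \<in> S \<Longrightarrow> D2 x u v = u \<bullet> (hessian g x *v v)"
  unfolding D2_def using hessian_eq[OF open_S _ C2_g] by simp

lemma local_norm_eq: "x \<in> S \<Longrightarrow> local_norm f x u = sqrt (D2 x u u)"
  by (simp add: local_norm_def D2_eq_hessian)

lemma D2_commute: "x \<in> S \<Longrightarrow> D2 x u v = D2 x v u"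
  unfolding D2_def by (rule dir_deriv_commute[OF open_S _ C2_g])

lemma linear_D2:
  assumes "x \<in> S" shows "linear (D2 x u)" "linear (\<lambda>u. D2 x u v)"
  unfolding D2_def[abs_def]
  by (rule linear_dir_deriv[OF differentiable_g(2)[OF assms]])
    (rule linear_dir_deriv2[OF open_S assms C2_g])

text \<open>These two transpositions generate all permutations. Exchanging the inner directions
  needs symmetry of the second derivative near \<open>x\<close>; exchanging the outer ones is
  symmetry for \<open>dir_deriv u g\<close>.\<close>

lemma D3_commute:
  assumes "x \<in> S"
  shows "D3 x u v w = D3 x v u w" "D3 x u v w = D3 x u w v"
proof -
  show "D3 x u v w = D3 x v u w"
    unfolding D3_def by (rule dir_deriv_cong[OF differentiable_g(3)[OF assms] open_S assms])
      (rule dir_deriv_commute[OF open_S _ C2_g])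
  show "D3 x u v w = D3 x u w v"
    unfolding D3_def by (rule dir_deriv_commute[OF open_S assms C2_dir_deriv])
qed

lemma linear_D3:
  assumes "x \<in> S" shows "linear (\<lambda>u. D3 x u v w)"
proof -
  have "D3 x u v w = D3 x v w u" for u using D3_commute[OF assms] by metis
  then show ?thesis
    using linear_dir_deriv[OF differentiable_g(3)[OF assms], of w v] by (simp add: D3_def)
qed

lemma DERIV_along_line:
  assumes "x + t *\<^sub>R v \<in> S"
  shows "((\<lambda>t. g (x + t *\<^sub>R v)) has_real_derivative dir_deriv v g (x + t *\<^sub>R v)) (at t)"
    "((\<lambda>t. dir_deriv u g (x + t *\<^sub>R v)) has_real_derivative D2 (x + t *\<^sub>R v) u v) (at t)"
    "((\<lambda>t. D2 (x + t *\<^sub>R v) u w) has_real_derivative D3 (x + t *\<^sub>R v) u w v) (at t)"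
  unfolding D2_def D3_def
  by (rule has_real_derivative_along_line differentiable_g assms)+

lemma open_line: "open {t. x + t *\<^sub>R v \<in> S}"
  using open_vimage[OF open_S, of "\<lambda>t. x + t *\<^sub>R v"]
  by (simp add: vimage_def continuous_intros)

text \<open>The link between the \<open>deriv\<close> powers in the definition of self-concordance
  and the forms \<open>D2\<close> and \<open>D3\<close>. Each level is proved at all parameters of
  an open set, because the next derivative depends on nearby values.\<close>

lemma higher_derivs_along_line:
  assumes "x + t *\<^sub>R v \<in> S"
  defines "\<phi> \<equiv> \<lambda>t. g (x + t *\<^sub>R v)"
  shows "(deriv ^^ 2) \<phi> t = D2 (x + t *\<^sub>R v) v v" "(deriv ^^ 3) \<phi> t = D3 (x + t *\<^sub>R v) v v v"
proof -
  let ?I = "{t. x + t *\<^sub>R v \<in> S}"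
  have 1: "deriv \<phi> t = dir_deriv v g (x + t *\<^sub>R v)" if "t \<in> ?I" for t
    using DERIV_along_line(1)[of x t v] that unfolding \<phi>_def by (intro DERIV_imp_deriv) auto
  have "(deriv \<phi> has_real_derivative D2 (x + t *\<^sub>R v) v v) (at t)" if "t \<in> ?I" for t
    by (rule has_field_derivative_transform_within_open[OF _ open_line that])
      (use that DERIV_along_line(2) 1 in simp_all)
  then have 2: "deriv (deriv \<phi>) t = D2 (x + t *\<^sub>R v) v v" if "t \<in> ?I" for t
    using that DERIV_imp_deriv by blast
  have "(deriv (deriv \<phi>) has_real_derivative D3 (x + t *\<^sub>R v) v v v) (at t)" if "t \<in> ?I" for t
    by (rule has_field_derivative_transform_within_open[OF _ open_line that])
      (use that DERIV_along_line(3) 2 in simp_all)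
  then have "deriv (deriv (deriv \<phi>)) t = D3 (x + t *\<^sub>R v) v v v" if "t \<in> ?I" for t
    using that DERIV_imp_deriv by blast
  with 2 assms show "(deriv ^^ 2) \<phi> t = D2 (x + t *\<^sub>R v) v v" "(deriv ^^ 3) \<phi> t = D3 (x + t *\<^sub>R v) v v v"
    by (simp_all add: eval_nat_numeral)
qed

lemma D3_diagonal_bound:
  assumes "x \<in> S" shows "\<bar>D3 x v v v\<bar> \<le> 2 * D2 x v v powr (3/2)"
proof -
  let ?\<phi> = "\<lambda>t. g (x + t *\<^sub>R v)"
  have in_S: "x + 0 *\<^sub>R v \<in> S" using assms by simp
  then have "\<bar>(deriv ^^ 3) ?\<phi> 0\<bar> \<le> 2 * (deriv ^^ 2) ?\<phi> 0 powr (3/2)"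
    using self_concordant assms unfolding standard_self_concordant_def Let_def by blast
  then show ?thesis
    using higher_derivs_along_line[OF in_S] by simp
qed

section \<open>Positive definiteness of the Hessian\<close>

lemma D2_nonneg:
  assumes x: "x \<in> S" shows "D2 x v v \<ge> 0"
proof -
  txt \<open>By midpoint convexity the mixed second difference in the directions \<open>v\<close> and \<open>- v\<close> is
    nonpositive, and it approximates \<open>- D2 x v v\<close>.\<close>
  let ?d = "\<lambda>t. (g (x + t *\<^sub>R v + t *\<^sub>R (- v)) - g (x + t *\<^sub>R v) - g (x + t *\<^sub>R (- v)) + g x) / t\<^sup>2"
  have "open ({t. x + t *\<^sub>R v \<in> S} \<inter> {t. x + t *\<^sub>R (- v) \<in> S})"
    by (intro open_Int open_line)
  then have "\<forall>\<^sub>F t in nhds 0. t \<in> {t. x + t *\<^sub>R v \<in> S} \<inter> {t. x + t *\<^sub>R (- v) \<in> S}"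
    by (rule eventually_nhds_in_open) (simp add: x)
  then have "\<forall>\<^sub>F t in at_right 0. t \<in> {t. x + t *\<^sub>R v \<in> S} \<inter> {t. x + t *\<^sub>R (- v) \<in> S}"
    unfolding eventually_at_filter by (rule eventually_mono) simp
  then have "\<forall>\<^sub>F t in at_right 0. ?d t \<le> 0"
  proof eventually_elim
    case (elim t)
    let ?y = "x + t *\<^sub>R v" and ?z = "x + t *\<^sub>R (- v)"
    have "(?y, g ?y) \<in> eepigraph f" "(?z, g ?z) \<in> eepigraph f"
      using elim by (auto simp: eepigraph_def f_eq)
    then have "(1/2) *\<^sub>R (?y, g ?y) + (1/2) *\<^sub>R (?z, g ?z) \<in> eepigraph f"
      using convex unfolding convex_fun_def by (intro convexD) auto
    moreover have "(1/2) *\<^sub>R ?y + (1/2) *\<^sub>R ?z = x"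
    proof -
      have "?y + ?z = x + x" by simp
      then show ?thesis by (simp only: scaleR_half_double flip: scaleR_add_right)
    qed
    ultimately have "f x \<le> ereal (g ?y / 2 + g ?z / 2)" by (simp add: eepigraph_def)
    then show ?case by (simp add: f_eq[OF x] divide_nonpos_nonneg)
  qed
  then have "dir_deriv (- v) (dir_deriv v g) x \<le> 0"
    using second_difference_tendsto[OF open_S x C2_g, of v "- v"]
    by (intro tendsto_upperbound) auto
  then show ?thesis
    using linear_neg[OF linear_D2(1)[OF x], of v v] by (simp add: D2_def)
qed

text \<open>Convexity gives only semidefiniteness. A vector on which the form vanishes lies in its
  radical, hence in the kernel of the Hessian, which nondegeneracy makes trivial.\<close>

lemma D2_pos:
  assumes x: "x \<in> S" and v: "v \<noteq> 0" shows "D2 x v v > 0"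
proof (rule ccontr)
  assume "\<not> D2 x v v > 0"
  then have vv: "D2 x v v = 0" using D2_nonneg[OF x, of v] by simp
  note lin = linear_add[OF linear_D2(1)[OF x]] linear_add[OF linear_D2(2)[OF x]]
    linear_scale[OF linear_D2(1)[OF x]] linear_scale[OF linear_D2(2)[OF x]]
  have "D2 x w v = 0" for w
  proof (rule ccontr)
    assume nz: "D2 x w v \<noteq> 0"
    have "0 \<le> D2 x (w + s *\<^sub>R v) (w + s *\<^sub>R v)" for s by (rule D2_nonneg[OF x])
    then have "0 \<le> D2 x w w + 2 * s * D2 x w v" for s
      by (simp add: lin vv D2_commute[OF x, of v w] algebra_simps)
    \<comment> \<open>The parameter is chosen so that the affine function of \<open>s\<close> takes
      the value -1.\<close>
    from this[of "- (D2 x w w + 1) / (2 * D2 x w v)"] have "0 \<le> D2 x w w - (D2 x w w + 1)"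
      using nz by (simp add: field_simps)
    then show False by simp
  qed
  then have "hessian g x *v v = 0"
    using D2_eq_hessian[OF x] by (metis inner_eq_zero_iff)
  moreover obtain B where "B ** hessian g x = mat 1"
    using nondegenerate[OF x] by (auto simp: invertible_def)
  ultimately have "v = 0"
    by (metis matrix_vector_mul_assoc matrix_vector_mul_lid matrix_vector_mult_0_right)
  with v show False by simp
qed

lemma inner_form_D2: "x \<in> S \<Longrightarrow> inner_form (D2 x)"
  by (intro inner_form.intro linear_D2 D2_commute D2_pos)

lemma D3_bound:
  assumes x: "x \<in> S" shows "\<bar>D3 x u u v\<bar> \<le> 2 * D2 x u u * sqrt (D2 x v v)"
  by (rule inner_form.symmetric_trilinear_bound[OF inner_form_D2[OF x]])
    (rule linear_D3[OF x] D3_commute[OF x] D3_diagonal_bound[OF x])+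

section \<open>Local norms and the Dikin ellipsoid\<close>

lemma local_norm_scaleR: "x \<in> S \<Longrightarrow> local_norm f x (t *\<^sub>R v) = \<bar>t\<bar> * local_norm f x v"
  by (simp add: local_norm_eq inner_form.Q_simps[OF inner_form_D2] real_sqrt_mult flip: mult.assoc)

lemma local_norm_nonneg: "x \<in> S \<Longrightarrow> 0 \<le> local_norm f x v"
  by (simp add: local_norm_eq D2_nonneg)

lemma local_norm_square: "x \<in> S \<Longrightarrow> (local_norm f x v)\<^sup>2 = D2 x v v"
  by (simp add: local_norm_eq D2_nonneg)

lemma local_norm_along_line_le:
  assumes line: "\<And>s. 0 \<le> s \<Longrightarrow> s \<le> t \<Longrightarrow> x + s *\<^sub>R v \<in> S"
    and t: "0 \<le> t" "local_norm f x v * t < 1"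
  shows "local_norm f (x + t *\<^sub>R v) v \<le> local_norm f x v / (1 - local_norm f x v * t)"
proof (cases "v = 0")
  case True
  then show ?thesis using line[of 0] t(1) by (simp add: local_norm_def)
next
  case False
  define q where "q = (\<lambda>s. D2 (x + s *\<^sub>R v) v v)"
  have q: "q s > 0" if "0 \<le> s" "s \<le> t" for s
    unfolding q_def by (rule D2_pos[OF line[OF that] False])
  txt \<open>Self-concordance says that \<open>1 / sqrt q\<close> has slope at least \<open>- 1\<close>.\<close>
  have "inverse (sqrt (q 0)) + 0 \<le> inverse (sqrt (q t)) + t"
  proof (rule DERIV_nonneg_imp_nondecreasing[OF t(1)])
    fix s assume s: "0 \<le> s" "s \<le> t"
    have q': "(q has_real_derivative D3 (x + s *\<^sub>R v) v v v) (at s)"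
      unfolding q_def by (rule DERIV_along_line(3)[OF line[OF s]])
    have deriv: "((\<lambda>s. inverse (sqrt (q s)) + s) has_real_derivative
        - (inverse (sqrt (q s)) * (D3 (x + s *\<^sub>R v) v v v * (inverse (sqrt (q s)) / 2)) * inverse (sqrt (q s))) + 1) (at s)"
      using q[OF s] by (auto intro!: derivative_eq_intros DERIV_chain2[OF DERIV_real_sqrt] q')
    have "D3 (x + s *\<^sub>R v) v v v \<le> 2 * q s * sqrt (q s)"
      using D3_bound[OF line[OF s], of v v] by (simp add: q_def)
    moreover have "2 * q s * sqrt (q s) = 2 * sqrt (q s) ^ 3"
      using q[OF s] by (simp add: power3_eq_cube)
    moreover have "inverse w * (D * (inverse w / 2)) * inverse w \<le> 1" if "D \<le> 2 * w ^ 3" "0 < w" for D w :: real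
      using that by (simp add: field_simps power3_eq_cube)
    ultimately have "inverse (sqrt (q s)) * (D3 (x + s *\<^sub>R v) v v v * (inverse (sqrt (q s)) / 2)) * inverse (sqrt (q s)) \<le> 1"
      using q[OF s] by simp
    with deriv show "\<exists>y. ((\<lambda>s. inverse (sqrt (q s)) + s) has_real_derivative y) (at s) \<and> 0 \<le> y"
      by (intro exI conjI) auto
  qed
  moreover have "local_norm f x v = sqrt (q 0)" "local_norm f (x + t *\<^sub>R v) v = sqrt (q t)"
    using line[of 0] line[of t] t(1) by (simp_all add: local_norm_eq q_def)
  moreover have "sqrt (q 0) > 0" "sqrt (q t) > 0" using q t(1) by simp_all
  ultimately show ?thesis using t(2) by (simp add: field_simps)
qed

lemma Dikin:
  assumes x: "x \<in> S" and v: "local_norm f x v < 1" shows "x + v \<in> S"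
proof (rule ccontr)
  assume out: "x + v \<notin> S"
  let ?r = "local_norm f x v"
  have r0: "0 \<le> ?r" by (rule local_norm_nonneg[OF x])
  txt \<open>At the first exit time \<open>T\<close> the values of \<open>f\<close> stay bounded, contradicting closedness of the
    epigraph.\<close>
  define N where "N = {0..1} \<inter> {t. x + t *\<^sub>R v \<notin> S}"
  have "closed {t. x + t *\<^sub>R v \<notin> S}"
    using open_line[of x v] by (simp add: closed_def Compl_eq)
  then have "compact N" unfolding N_def by (intro compact_Int_closed) auto
  moreover have "1 \<in> N" using out by (simp add: N_def)
  ultimately obtain T where T: "T \<in> N" "\<And>t. t \<in> N \<Longrightarrow> T \<le> t"
    using compact_attains_inf[of N] by blast
  have T': "0 \<le> T" "T \<le> 1" "x + T *\<^sub>R v \<notin> S" using T by (auto simp: N_def)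
  have line: "x + s *\<^sub>R v \<in> S" if "0 \<le> s" "s < T" for s
    using T(2)[of s] T' that by (force simp: N_def)
  have "T \<noteq> 0" using T' x by auto
  then have T0: "0 < T" using T' by simp
  \<comment> \<open>Before the exit time the second derivative along the line is at most
    \<open>M\<close>. Two integrations over a parameter length of at most 1 bound the slope by
    \<open>c\<close> and the values by \<open>B\<close>.\<close>
  define M where "M = (?r / (1 - ?r))\<^sup>2"
  define c where "c = \<bar>dir_deriv v g x\<bar> + M"
  have M: "M \<ge> 0" by (simp add: M_def)
  have D2M: "\<bar>D2 (x + s *\<^sub>R v) v v\<bar> \<le> M" if s: "0 \<le> s" "s < T" for s
  proof -
    have rs: "?r * s \<le> ?r" using s T' r0 by (simp add: mult_left_le)
    have "local_norm f (x + s *\<^sub>R v) v \<le> ?r / (1 - ?r * s)"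
      using line s rs v by (intro local_norm_along_line_le) auto
    also have "\<dots> \<le> ?r / (1 - ?r)" using r0 rs v by (intro divide_left_mono mult_pos_pos) auto
    finally have "(local_norm f (x + s *\<^sub>R v) v)\<^sup>2 \<le> M"
      unfolding M_def by (intro power_mono local_norm_nonneg line s)
    then show ?thesis using line[OF s] by (simp add: local_norm_square D2_nonneg)
  qed
  have D1c: "\<bar>dir_deriv v g (x + s *\<^sub>R v)\<bar> \<le> c" if s: "0 \<le> s" "s < T" for s
  proof -
    have "\<bar>dir_deriv v g (x + s *\<^sub>R v) - dir_deriv v g (x + 0 *\<^sub>R v)\<bar> \<le> M * s - M * 0"
      using s by (intro DERIV_abs_diff_le[where a' = "\<lambda>s. D2 (x + s *\<^sub>R v) v v" and b' = "\<lambda>_. M"] DERIV_along_line(2) line D2M)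
        (auto intro!: derivative_eq_intros)
    also have "\<dots> \<le> M" using s T' M by (simp add: mult_left_le)
    finally show ?thesis by (simp add: c_def)
  qed
  have c: "c \<ge> 0" using M by (simp add: c_def)
  define B where "B = \<bar>g x\<bar> + c"
  have gB: "g (x + s *\<^sub>R v) \<le> B" if s: "0 \<le> s" "s < T" for s
  proof -
    have "\<bar>g (x + s *\<^sub>R v) - g (x + 0 *\<^sub>R v)\<bar> \<le> c * s - c * 0"
      using s by (intro DERIV_abs_diff_le[where a' = "\<lambda>s. dir_deriv v g (x + s *\<^sub>R v)" and b' = "\<lambda>_. c"] DERIV_along_line(1) line D1c)
        (auto intro!: derivative_eq_intros)
    also have "\<dots> \<le> c" using s T' c by (simp add: mult_left_le)
    finally show ?thesis by (simp add: B_def)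
  qed
  \<comment> \<open>At the fixed height \<open>B\<close> the epigraph cuts out a closed set of
    parameters, which therefore contains the left limit \<open>T\<close> as well.\<close>
  let ?E = "(\<lambda>s. (x + s *\<^sub>R v, B)) -` eepigraph f"
  have "closed ?E"
    using closed unfolding closed_fun_def
    by (intro continuous_closed_vimage) (auto intro!: continuous_intros)
  moreover have "{0..<T} \<subseteq> ?E"
    using gB line by (auto simp: eepigraph_def f_eq)
  ultimately have "closure {0..<T} \<subseteq> ?E" by (rule closure_minimal[rotated])
  moreover have "T \<in> closure {0..<T}" using T0 by (simp add: closure_atLeastLessThan)
  ultimately have "T \<in> ?E" by blast
  then have "f (x + T *\<^sub>R v) < \<infinity>" by (auto simp: eepigraph_def less_ereal.simps order.strict_trans1)
  then show False using T' by (simp add: edom_def)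
qed

lemma Dikin_segment:
  assumes x: "x \<in> S" and v: "local_norm f x v < 1" and t: "0 \<le> t" "t \<le> 1"
  shows "x + t *\<^sub>R v \<in> S" "local_norm f x v * t < 1"
    "local_norm f (x + t *\<^sub>R v) v \<le> local_norm f x v / (1 - local_norm f x v * t)"
proof -
  have *: "local_norm f x v * t < 1" if "0 \<le> t" "t \<le> 1" for t
    using mult_left_le[of t "local_norm f x v"] local_norm_nonneg[OF x, of v] v that by linarith
  have seg: "x + t *\<^sub>R v \<in> S" if "0 \<le> t" "t \<le> 1" for t
    using *[OF that] that by (intro Dikin[OF x]) (simp add: local_norm_scaleR[OF x] mult.commute)
  from seg[OF t] show "x + t *\<^sub>R v \<in> S" .
  from *[OF t] show "local_norm f x v * t < 1" .
  show "local_norm f (x + t *\<^sub>R v) v \<le> local_norm f x v / (1 - local_norm f x v * t)"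
    using seg t *[OF t] by (intro local_norm_along_line_le) auto
qed

text \<open>Along the segment the form q satisfies |q'| \<le> 2 q r / (1 - r s), so q (1 - r s)^2 is
  nonincreasing and q / (1 - r s)^2 is nondecreasing. These products avoid the logarithm of q, which
  vanishes for \<open>u = 0\<close>.\<close>

lemma D2_comparison:
  assumes x: "x \<in> S" and v: "local_norm f x v < 1"
  shows "D2 (x + v) u u \<le> D2 x u u / (1 - local_norm f x v)\<^sup>2"
    and "(1 - local_norm f x v)\<^sup>2 * D2 x u u \<le> D2 (x + v) u u"
proof -
  let ?r = "local_norm f x v"
  define q where "q = (\<lambda>s. D2 (x + s *\<^sub>R v) u u)"
  define q' where "q' = (\<lambda>s. D3 (x + s *\<^sub>R v) u u v)"
  have q: "0 \<le> q s" "(q has_real_derivative q' s) (at s)" "\<bar>q' s\<bar> * (1 - ?r * s) \<le> 2 * q s * ?r" "0 < 1 - ?r * s"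
    if s: "0 \<le> s" "s \<le> 1" for s
  proof -
    note seg = Dikin_segment[OF x v s]
    show q0: "0 \<le> q s" unfolding q_def by (rule D2_nonneg[OF seg(1)])
    show "(q has_real_derivative q' s) (at s)" 
      unfolding q_def q'_def by (rule DERIV_along_line(3)[OF seg(1)])
    show pos: "0 < 1 - ?r * s" using seg(2) by simp
    have "\<bar>q' s\<bar> \<le> 2 * q s * local_norm f (x + s *\<^sub>R v) v"
      using D3_bound[OF seg(1), of u v] by (simp add: q_def q'_def local_norm_eq[OF seg(1)])
    also have "\<dots> \<le> 2 * q s * (?r / (1 - ?r * s))"
      using q0 by (intro mult_left_mono seg(3)) auto
    finally show "\<bar>q' s\<bar> * (1 - ?r * s) \<le> 2 * q s * ?r" using pos by (simp add: field_simps)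
  qed
  have r: "1 - ?r > 0" using v by simp
  have "q 1 * (1 - ?r * 1)\<^sup>2 \<le> q 0 * (1 - ?r * 0)\<^sup>2"
  proof (rule DERIV_nonpos_imp_nonincreasing[of 0 1])
    fix s :: real assume s: "0 \<le> s" "s \<le> 1"
    have "((\<lambda>s. q s * (1 - ?r * s)\<^sup>2) has_real_derivative (1 - ?r * s) * (q' s * (1 - ?r * s) - 2 * q s * ?r)) (at s)"
      by (auto intro!: derivative_eq_intros q(2)[OF s] simp: power2_eq_square algebra_simps)
    moreover have "q' s * (1 - ?r * s) \<le> \<bar>q' s\<bar> * (1 - ?r * s)"
      using q(4)[OF s] by (intro mult_right_mono) auto
    then have "q' s * (1 - ?r * s) - 2 * q s * ?r \<le> 0" using q(3)[OF s] by linarith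
    then have "(1 - ?r * s) * (q' s * (1 - ?r * s) - 2 * q s * ?r) \<le> 0"
      using less_imp_le[OF q(4)[OF s]] by (rule mult_nonneg_nonpos[rotated])
    ultimately show "\<exists>y. ((\<lambda>s. q s * (1 - ?r * s)\<^sup>2) has_real_derivative y) (at s) \<and> y \<le> 0" by blast
  qed simp
  then show "D2 (x + v) u u \<le> D2 x u u / (1 - ?r)\<^sup>2"
    using r by (simp add: q_def field_simps)
  have "q 0 / (1 - ?r * 0)\<^sup>2 \<le> q 1 / (1 - ?r * 1)\<^sup>2"
  proof (rule DERIV_nonneg_imp_nondecreasing[of 0 1])
    fix s :: real assume s: "0 \<le> s" "s \<le> 1"
    have "((\<lambda>s. q s / (1 - ?r * s)\<^sup>2) has_real_derivative
        (q' s * (1 - ?r * s) + 2 * q s * ?r) / (1 - ?r * s)^3) (at s)"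
      using q(4)[OF s]
      by (auto intro!: derivative_eq_intros q(2)[OF s] simp: power2_eq_square power3_eq_cube divide_simps) (simp add: algebra_simps)
    moreover have "- q' s * (1 - ?r * s) \<le> \<bar>q' s\<bar> * (1 - ?r * s)"
      using q(4)[OF s] by (intro mult_right_mono) auto
    then have "0 \<le> q' s * (1 - ?r * s) + 2 * q s * ?r"
      using q(3)[OF s] by (simp only: mult_minus_left)
    then have "0 \<le> (q' s * (1 - ?r * s) + 2 * q s * ?r) / (1 - ?r * s)^3"
      using q(4)[OF s] by (intro divide_nonneg_pos zero_less_power)
    ultimately show "\<exists>y. ((\<lambda>s. q s / (1 - ?r * s)\<^sup>2) has_real_derivative y) (at s) \<and> 0 \<le> y" by blast
  qed simp
  then show "(1 - ?r)\<^sup>2 * D2 x u u \<le> D2 (x + v) u u"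
    using r by (simp add: q_def field_simps)
qed

lemma local_norm_comparison:
  assumes x: "x \<in> S" and v: "local_norm f x v < 1"
  shows "local_norm f (x + v) u \<le> local_norm f x u / (1 - local_norm f x v)"
    and "local_norm f x u \<le> local_norm f (x + v) u / (1 - local_norm f x v)"
proof -
  have r: "1 - local_norm f x v > 0" using v by simp
  note xv = Dikin[OF x v]
  show "local_norm f (x + v) u \<le> local_norm f x u / (1 - local_norm f x v)"
    using real_sqrt_le_mono[OF D2_comparison(1)[OF x v, of u]] r
    by (simp add: local_norm_eq[OF x, of u] local_norm_eq[OF xv] real_sqrt_divide)
  have "(1 - local_norm f x v) * local_norm f x u \<le> local_norm f (x + v) u"
    using real_sqrt_le_mono[OF D2_comparison(2)[OF x v, of u]] r
    by (simp add: local_norm_eq[OF x, of u] local_norm_eq[OF xv] real_sqrt_mult)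
  then show "local_norm f x u \<le> local_norm f (x + v) u / (1 - local_norm f x v)"
    using r by (simp add: field_simps)
qed

text \<open>A dual norm estimate, tested against an arbitrary \<open>e\<close>. Integrating the
  bound on the third derivative gives r / (1 - r s)^2 - r, and integrating once more over [0, 1]
  gives 1 / (1 - r) - 1 - r = r^2 / (1 - r).\<close>

lemma gradient_taylor_bound:
  assumes x: "x \<in> S" and v: "local_norm f x v < 1"
  shows "\<bar>e \<bullet> gradient g (x + v) - e \<bullet> gradient g x - D2 x e v\<bar>
    \<le> local_norm f x e * ((local_norm f x v)\<^sup>2 / (1 - local_norm f x v))"
proof -
  let ?r = "local_norm f x v" and ?n = "local_norm f x e"
  have r0: "0 \<le> ?r" and n0: "0 \<le> ?n" by (rule local_norm_nonneg[OF x])+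
  have second: "\<bar>D2 (x + s *\<^sub>R v) e v - D2 x e v\<bar> \<le> ?n * (?r / (1 - ?r * s)\<^sup>2 - ?r)"
    if s: "0 \<le> s" "s \<le> 1" for s
  proof -
    have "\<bar>D2 (x + s *\<^sub>R v) e v - D2 (x + 0 *\<^sub>R v) e v\<bar> \<le> ?n * ?r / (1 - ?r * s)\<^sup>2 - ?n * ?r / (1 - ?r * 0)\<^sup>2"
    proof (rule DERIV_abs_diff_le[OF s(1)])
      fix u assume "0 \<le> u" "u \<le> s"
      then have u: "0 \<le> u" "u \<le> 1" using s by auto
      note seg = Dikin_segment[OF x v u]
      show "((\<lambda>s. D2 (x + s *\<^sub>R v) e v) has_real_derivative D3 (x + u *\<^sub>R v) e v v) (at u)"
        by (rule DERIV_along_line(3)[OF seg(1)])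
      have pos: "1 - ?r * u > 0" using seg(2) by simp
      then show "((\<lambda>s. ?n * ?r / (1 - ?r * s)\<^sup>2) has_real_derivative 2 * ?n * ?r\<^sup>2 / (1 - ?r * u)^3) (at u)"
        by (auto intro!: derivative_eq_intros simp: power2_eq_square power3_eq_cube divide_simps)
      have ue: "local_norm f (x + u *\<^sub>R v) e \<le> ?n / (1 - ?r * u)"
        using local_norm_comparison(1)[OF x, of "u *\<^sub>R v" e] seg(2) u
        by (simp add: local_norm_scaleR[OF x] mult.commute)
      \<comment> \<open>Symmetry moves the repeated direction \<open>v\<close> to the first two
        places, where the sharp trilinear bound applies.\<close>
      have "D3 (x + u *\<^sub>R v) e v v = D3 (x + u *\<^sub>R v) v v e"
        using D3_commute[OF seg(1)] by metis
      then have "\<bar>D3 (x + u *\<^sub>R v) e v v\<bar> \<le> 2 * (local_norm f (x + u *\<^sub>R v) v)\<^sup>2 * local_norm f (x + u *\<^sub>R v) e"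
        using D3_bound[OF seg(1), of v e] by (simp add: local_norm_square[OF seg(1)] local_norm_eq[OF seg(1), of e])
      also have "\<dots> \<le> 2 * (?r / (1 - ?r * u))\<^sup>2 * (?n / (1 - ?r * u))"
        using pos r0 by (intro mult_mono power_mono seg(3) ue mult_left_mono local_norm_nonneg[OF seg(1)]) auto
      also have "\<dots> = 2 * ?n * ?r\<^sup>2 / (1 - ?r * u)^3"
        by (simp add: power2_eq_square power3_eq_cube mult_ac)
      finally show "\<bar>D3 (x + u *\<^sub>R v) e v v\<bar> \<le> 2 * ?n * ?r\<^sup>2 / (1 - ?r * u)^3" .
    qed
    then show ?thesis by (simp add: algebra_simps)
  qed
  have "\<bar>(dir_deriv e g (x + 1 *\<^sub>R v) - 1 * D2 x e v) - (dir_deriv e g (x + 0 *\<^sub>R v) - 0 * D2 x e v)\<bar>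
    \<le> ?n * (1 / (1 - ?r * 1) - ?r * 1) - ?n * (1 / (1 - ?r * 0) - ?r * 0)"
  proof (rule DERIV_abs_diff_le[where a' = "\<lambda>s. D2 (x + s *\<^sub>R v) e v - D2 x e v"
        and b' = "\<lambda>s. ?n * (?r / (1 - ?r * s)\<^sup>2 - ?r)"])
    fix s :: real assume s: "0 \<le> s" "s \<le> 1"
    show "((\<lambda>s. dir_deriv e g (x + s *\<^sub>R v) - s * D2 x e v) has_real_derivative D2 (x + s *\<^sub>R v) e v - D2 x e v) (at s)"
      by (auto intro!: derivative_eq_intros DERIV_along_line(2) Dikin_segment[OF x v s])
    have "1 - ?r * s > 0" using Dikin_segment(2)[OF x v s] by simp
    then show "((\<lambda>s. ?n * (1 / (1 - ?r * s) - ?r * s)) has_real_derivative ?n * (?r / (1 - ?r * s)\<^sup>2 - ?r)) (at s)"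
      by (intro DERIV_cmult) (auto intro!: derivative_eq_intros simp: power2_eq_square)
    show "\<bar>D2 (x + s *\<^sub>R v) e v - D2 x e v\<bar> \<le> ?n * (?r / (1 - ?r * s)\<^sup>2 - ?r)" by (rule second[OF s])
  qed simp
  moreover have "?n * (1 / (1 - ?r * 1) - ?r * 1) - ?n * (1 / (1 - ?r * 0) - ?r * 0) = ?n * (?r\<^sup>2 / (1 - ?r))"
  proof -
    have "1 / (1 - ?r) - ?r - 1 = ?r\<^sup>2 / (1 - ?r)" using v by (simp add: field_simps power2_eq_square)
    moreover have "?n * (1 / (1 - ?r * 1) - ?r * 1) - ?n * (1 / (1 - ?r * 0) - ?r * 0) = ?n * (1 / (1 - ?r) - ?r - 1)"
      by (simp add: right_diff_distrib)
    ultimately show ?thesis by simp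
  qed
  ultimately show ?thesis
    using gradient_eq(2)[OF differentiable_g(1)[OF x]] gradient_eq(2)[OF differentiable_g(1)[OF Dikin[OF x v]]]
    by (simp add: algebra_simps)
qed

end

section \<open>Convergence of the full-step scheme\<close>

context nondegenerate_self_concordant
begin

lemma first_order_optimality:
  assumes xs: "xs \<in> S" and X: "convex X" and min: "is_arg_min f (\<lambda>x. x \<in> X) xs" and z: "z \<in> X"
  shows "0 \<le> (z - xs) \<bullet> gradient g xs"
proof (rule ccontr)
  let ?v = "z - xs"
  assume "\<not> ?thesis"
  then have "dir_deriv ?v g xs < 0" by (simp add: gradient_eq(2)[OF differentiable_g(1)[OF xs]])
  moreover have "((\<lambda>t. g (xs + t *\<^sub>R ?v)) has_real_derivative dir_deriv ?v g xs) (at 0)"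
    using DERIV_along_line(1)[of xs 0 ?v] xs by simp
  ultimately obtain d where d: "d > 0" "\<And>t. 0 < t \<Longrightarrow> t < d \<Longrightarrow> g (xs + t *\<^sub>R ?v) < g xs"
    using DERIV_neg_dec_right[of "\<lambda>t. g (xs + t *\<^sub>R ?v)" "dir_deriv ?v g xs" 0] by auto
  obtain d' where d': "d' > 0" "\<And>t. dist t 0 < d' \<Longrightarrow> xs + t *\<^sub>R ?v \<in> S"
  proof -
    have "0 \<in> {t. xs + t *\<^sub>R ?v \<in> S}" using xs by simp
    then obtain d' where "d' > 0" "ball 0 d' \<subseteq> {t. xs + t *\<^sub>R ?v \<in> S}"
      using open_line openE by blast
    then show ?thesis using that[of d'] by (auto simp: subset_eq dist_commute)
  qed
  \<comment> \<open>Small enough for descent, for staying in the domain and for being a convex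
    combination; halving makes the first two strict.\<close>
  define t where "t = min (min d d') 1 / 2"
  have t: "0 < t" "t < d" "t < d'" "t \<le> 1" using d d' by (auto simp: t_def)
  have in_S: "xs + t *\<^sub>R ?v \<in> S" using d'(2)[of t] t by simp
  have "xs \<in> X" using min by (simp add: is_arg_min_def)
  then have "(1 - t) *\<^sub>R xs + t *\<^sub>R z \<in> X" using convexD_alt[OF X _ z] t by simp
  moreover have "(1 - t) *\<^sub>R xs + t *\<^sub>R z = xs + t *\<^sub>R ?v" by (simp add: algebra_simps)
  moreover have "f (xs + t *\<^sub>R ?v) < f xs" using d(2)[of t] t by (simp add: f_eq in_S xs)
  ultimately show False using min by (auto simp: is_arg_min_def)
qed

text \<open>The error is estimated in the norm at \<open>x\<close>, where the model Hessian is the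
  inner product, and only at the end carried over to the norm at \<open>xs\<close>. The gradient
  estimate is applied from \<open>x\<close> in the direction \<open>- d\<close>, that is, towards
  \<open>xs\<close>.\<close>

lemma inexact_Newton_step:
  assumes xs: "xs \<in> S" and X: "convex X" and min: "is_arg_min f (\<lambda>x. x \<in> X) xs" and z: "z \<in> X"
    and x: "local_norm f xs (x - xs) \<le> l" and l: "l \<le> \<beta>" "\<beta> < 1/2" and \<eta>: "0 \<le> \<eta>"
    and gap: "(gradient g x + hessian g x *v (z - x)) \<bullet> (z - xs) \<le> \<eta>\<^sup>2"
  shows "local_norm f xs (z - xs) \<le> \<eta> / (1 - \<beta>) + l\<^sup>2 / ((1 - 2 * \<beta>) * (1 - \<beta>)\<^sup>2)"
proof -
  define d where "d = x - xs"
  define e where "e = z - xs"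
  define m where "m = local_norm f xs d"
  define r where "r = local_norm f x (- d)"
  define a where "a = local_norm f x e"
  have m: "0 \<le> m" "m \<le> l" "m < 1" "m < 1/2" using x l local_norm_nonneg[OF xs] by (auto simp: m_def d_def)
  then have l0: "0 \<le> l" by simp
  have xS: "x \<in> S" using Dikin[OF xs, of d] m by (simp add: m_def d_def)
  have "r = local_norm f x d"
    using local_norm_scaleR[OF xS, of "-1" d] by (simp add: r_def)
  then have rm: "r \<le> m / (1 - m)"
    using local_norm_comparison(1)[OF xs, of d d] m by (simp add: m_def d_def)
  define \<rho> where "\<rho> = l / (1 - \<beta>)"
  have "m / (1 - m) \<le> \<rho>" unfolding \<rho>_def using m l by (intro frac_le) auto
  with rm have r\<rho>: "r \<le> \<rho>" by simp
  have \<rho>1: "\<rho> \<le> \<beta> / (1 - \<beta>)" unfolding \<rho>_def using l by (intro divide_right_mono) auto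
  also have "\<beta> / (1 - \<beta>) < 1" using l by (simp add: field_simps)
  finally have "\<rho> < 1" .
  then have r1: "r < 1" using r\<rho> by simp
  have r0: "0 \<le> r" and a0: "0 \<le> a" using local_norm_nonneg[OF xS] by (auto simp: r_def a_def)
  note lin = linear_add[OF linear_D2(1)[OF xS]] 
  \<comment> \<open>This splits the Hessian term of the gap into the square of \<open>a\<close> and
    a cross term that cancels the linear term of the gradient estimate.\<close>
  have "z - x = e + (- d)" by (simp add: e_def d_def)
  then have "gradient g x \<bullet> e + (a\<^sup>2 + D2 x e (- d)) \<le> \<eta>\<^sup>2"
    using gap by (simp only: inner_add_left inner_commute[of "hessian g x *v _"]
        D2_eq_hessian[OF xS, symmetric] lin a_def local_norm_square[OF xS] e_def[symmetric])
  moreover have "0 \<le> e \<bullet> gradient g xs"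
    unfolding e_def by (rule first_order_optimality[OF xs X min z])
  moreover have "\<bar>e \<bullet> gradient g xs - e \<bullet> gradient g x - D2 x e (- d)\<bar> \<le> a * (r\<^sup>2 / (1 - r))"
    using gradient_taylor_bound[OF xS, of "- d" e] r1 by (simp add: a_def r_def d_def)
  ultimately have "a\<^sup>2 \<le> \<eta>\<^sup>2 + a * (r\<^sup>2 / (1 - r))"
    by (simp add: inner_commute[of "gradient g x"])
  moreover have B: "r\<^sup>2 / (1 - r) \<le> \<rho>\<^sup>2 / (1 - \<beta> / (1 - \<beta>))"
    using r0 r\<rho> \<rho>1 \<open>\<beta> / (1 - \<beta>) < 1\<close> by (intro frac_le power_mono) auto
  define B where "B = \<rho>\<^sup>2 / (1 - \<beta> / (1 - \<beta>))"
  have B0: "0 \<le> B" unfolding B_def using \<open>\<beta> / (1 - \<beta>) < 1\<close> by (intro divide_nonneg_pos) auto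
  have "a * (r\<^sup>2 / (1 - r)) \<le> a * B" unfolding B_def using a0 B by (rule mult_left_mono[rotated])
  ultimately have quad: "a\<^sup>2 \<le> \<eta>\<^sup>2 + a * B" by linarith
  \<comment> \<open>If \<open>a\<close> exceeded this sum, then a^2 > a \<eta> + a B \<ge> \<eta>^2
    + a B, against \<open>quad\<close>.\<close>
  have "a \<le> \<eta> + B"
  proof (rule ccontr)
    assume "\<not> a \<le> \<eta> + B"
    then have gt: "a > \<eta> + B" by simp
    then have "\<eta> * \<eta> \<le> a * \<eta>" using \<eta> B0 by (intro mult_right_mono) auto
    moreover have "a * (\<eta> + B) < a * a" using gt \<eta> B0 by (intro mult_strict_left_mono) auto
    ultimately show False using quad by (simp add: power2_eq_square algebra_simps)
  qed
  have "local_norm f xs e \<le> a / (1 - m)"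
    using local_norm_comparison(2)[OF xs, of d e] m by (simp add: m_def a_def d_def)
  also have "\<dots> \<le> (\<eta> + B) / (1 - \<beta>)"
    using \<open>a \<le> \<eta> + B\<close> a0 m l by (intro frac_le) auto
  also have "\<dots> = \<eta> / (1 - \<beta>) + l\<^sup>2 / ((1 - 2 * \<beta>) * (1 - \<beta>)\<^sup>2)"
  proof -
    have pos: "1 - \<beta> > 0" "1 - 2 * \<beta> > 0" using l by auto
    have "1 - \<beta> / (1 - \<beta>) = (1 - 2 * \<beta>) / (1 - \<beta>)" using pos by (simp add: field_simps)
    then have "B / (1 - \<beta>) = l\<^sup>2 / ((1 - 2 * \<beta>) * (1 - \<beta>)\<^sup>2)"
      unfolding B_def \<rho>_def using pos by (simp add: power_divide power2_eq_square)
    then show ?thesis by (simp add: add_divide_distrib)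
  qed
  finally show ?thesis by (simp add: e_def)
qed

text \<open>The Hessian comparison reduces every \<open>x\<close> in the ball to the single matrix
  at \<open>xs\<close>, whose form on differences of points of \<open>X\<close> is bounded by its
  operator norm and the size of \<open>X\<close>.\<close>

lemma uniform_curvature_bound:
  assumes xs: "xs \<in> S" and X: "compact X" and \<beta>: "\<beta> < 1"
  obtains K where "1 \<le> K"
    "\<And>x u v. local_norm f xs (x - xs) \<le> \<beta> \<Longrightarrow> u \<in> X \<Longrightarrow> v \<in> X \<Longrightarrow>
      (v - u) \<bullet> (hessian g x *v (v - u)) \<le> K"
proof -
  obtain R where R: "\<And>u. u \<in> X \<Longrightarrow> norm u \<le> R"
    using compact_imp_bounded[OF X] by (auto simp: bounded_iff)
  define M where "M = onorm ((*v) (hessian g xs))"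
  have M: "norm (hessian g xs *v w) \<le> M * norm w" for w
    unfolding M_def by (rule onorm[OF matrix_vector_mul_bounded_linear])
  have M0: "M \<ge> 0" unfolding M_def by (rule onorm_pos_le[OF matrix_vector_mul_bounded_linear])
  \<comment> \<open>The maximum with 1 ensures that every tolerance \<eta>_k^2 \<le> 1 is at most
    \<open>K\<close>, as the Frank-Wolfe bound requires.\<close>
  define K where "K = max 1 (M * (2 * R)\<^sup>2 / (1 - \<beta>)\<^sup>2)"
  show ?thesis
  proof (rule that[of K])
    show "1 \<le> K" by (simp add: K_def)
    fix x u v assume x: "local_norm f xs (x - xs) \<le> \<beta>" and uv: "u \<in> X" "v \<in> X"
    let ?w = "v - u"
    have x1: "local_norm f xs (x - xs) < 1" using x \<beta> by simp
    have xS: "x \<in> S" using Dikin[OF xs x1] by simp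
    have "D2 xs ?w ?w = ?w \<bullet> (hessian g xs *v ?w)" by (rule D2_eq_hessian[OF xs])
    also have "\<dots> \<le> norm ?w * norm (hessian g xs *v ?w)" by (rule norm_cauchy_schwarz)
    also have "\<dots> \<le> norm ?w * (M * norm ?w)" by (intro mult_left_mono M) auto
    also have "\<dots> = M * (norm ?w)\<^sup>2" by (simp add: power2_eq_square)
    also have "\<dots> \<le> M * (2 * R)\<^sup>2"
      using norm_triangle_ineq4[of v u] R[OF uv(1)] R[OF uv(2)]
      by (intro mult_left_mono power_mono M0) auto
    finally have 1: "D2 xs ?w ?w \<le> M * (2 * R)\<^sup>2" .
    have "?w \<bullet> (hessian g x *v ?w) = D2 x ?w ?w" by (simp add: D2_eq_hessian[OF xS])
    also have "\<dots> \<le> D2 xs ?w ?w / (1 - local_norm f xs (x - xs))\<^sup>2"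
      using D2_comparison(1)[OF xs x1, of ?w] by simp
    also have "\<dots> \<le> M * (2 * R)\<^sup>2 / (1 - \<beta>)\<^sup>2"
      using 1 x \<beta> M0 by (intro frac_le power_mono) auto
    also have "\<dots> \<le> K" by (simp add: K_def)
    finally show "?w \<bullet> (hessian g x *v ?w) \<le> K" .
  qed
qed

text \<open>The distance bound is part of the induction because the next run depends on it: it puts
  the iterate into the domain and within reach of the uniform curvature bound
  \<open>K\<close>.\<close>

lemma full_step_convergence:
  assumes xs: "xs \<in> S" and X: "convex X" "compact X" and min: "is_arg_min f (\<lambda>x. x \<in> X) xs"
    and x0: "x0 \<in> X" "local_norm f xs (x0 - xs) \<le> \<beta>"
    and \<sigma>: "0 < \<sigma>" "\<sigma> < 1" and \<beta>: "0 < \<beta>" "\<beta> < 1/2" and C: "1 < C"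
    and contraction: "1 / (C * (1 - \<beta>)) + \<beta> / ((1 - 2 * \<beta>) * (1 - \<beta>)\<^sup>2) \<le> \<sigma>"
    and K: "1 \<le> K" "\<And>x u v. local_norm f xs (x - xs) \<le> \<beta> \<Longrightarrow> u \<in> X \<Longrightarrow> v \<in> X \<Longrightarrow>
      (v - u) \<bullet> (hessian g x *v (v - u)) \<le> K"
    and lmo: "\<And>k t. is_LMO X (lmo k t)"
  defines "\<eta> \<equiv> \<lambda>k::nat. \<beta> * \<sigma> ^ k / C"
  shows "\<exists>s. full_step f \<eta> lmo x0 k = Some s \<and> iterate s \<in> X \<and>
    local_norm f xs (iterate s - xs) \<le> \<beta> * \<sigma> ^ k \<and>
    gradient_evals s = k \<and> hessian_evals s = k \<and>
    real (lmo_calls s) \<le> (\<Sum>j<k. 4 * K / (\<eta> j)\<^sup>2 + 1)"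
proof (induction k)
  case 0
  then show ?case using x0 by simp
next
  case (Suc k)
  then obtain s where s: "full_step f \<eta> lmo x0 k = Some s" "iterate s \<in> X"
    "local_norm f xs (iterate s - xs) \<le> \<beta> * \<sigma> ^ k" "gradient_evals s = k" "hessian_evals s = k"
    "real (lmo_calls s) \<le> (\<Sum>j<k. 4 * K / (\<eta> j)\<^sup>2 + 1)" by blast
  let ?x = "iterate s"
  have \<sigma>k: "0 < \<sigma> ^ k" "\<sigma> ^ k \<le> 1" using \<sigma> by (auto intro: power_le_one)
  have l: "\<beta> * \<sigma> ^ k \<le> \<beta>" "0 < \<beta> * \<sigma> ^ k" using \<sigma>k \<beta> by (simp_all add: mult_left_le)
  have x\<beta>: "local_norm f xs (?x - xs) \<le> \<beta>" using s(3) l by simp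
  then have xS: "?x \<in> S" using Dikin[OF xs, of "?x - xs"] \<beta> by simp
  have "\<beta> * \<sigma> ^ k \<le> C" using l(1) \<beta> C by linarith
  then have \<eta>: "0 < \<eta> k" "\<eta> k \<le> 1"
    using l(2) C by (simp_all add: \<eta>_def del: zero_less_mult_iff)
  then have \<eta>2: "0 < (\<eta> k)\<^sup>2" "(\<eta> k)\<^sup>2 \<le> K"
    using K(1) power_le_one[of "\<eta> k" 2] by auto
  obtain z n where zn: "FW (lmo k) (gradient g ?x) (hessian g ?x) ?x ((\<eta> k)\<^sup>2) = Some (z, n)" "z \<in> X"
    "real n \<le> 4 * K / (\<eta> k)\<^sup>2 + 1"
    "\<And>s. s \<in> X \<Longrightarrow> (gradient g ?x + hessian g ?x *v (z - ?x)) \<bullet> (z - s) \<le> (\<eta> k)\<^sup>2"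
  proof (rule FW_terminates[where lmo = "lmo k" and q = "gradient g ?x", OF X s(2) lmo _ _ _ \<eta>2])
    show "u \<bullet> (hessian g ?x *v v) = v \<bullet> (hessian g ?x *v u)" for u v
      using D2_commute[OF xS, of u v] by (simp add: D2_eq_hessian[OF xS])
    show "0 < u \<bullet> (hessian g ?x *v u)" if "u \<noteq> 0" for u
      using D2_pos[OF xS that] by (simp add: D2_eq_hessian[OF xS])
    show "(v - u) \<bullet> (hessian g ?x *v (v - u)) \<le> K" if "u \<in> X" "v \<in> X" for u v
      by (rule K(2)[OF x\<beta> that])
  qed blast
  have "xs \<in> X" using min by (simp add: is_arg_min_def)
  have "local_norm f xs (z - xs) \<le> \<eta> k / (1 - \<beta>) + (\<beta> * \<sigma> ^ k)\<^sup>2 / ((1 - 2 * \<beta>) * (1 - \<beta>)\<^sup>2)"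
    using zn(4)[OF \<open>xs \<in> X\<close>] \<eta>(1) by (intro inexact_Newton_step[OF xs X(1) min zn(2) s(3) l(1) \<beta>(2)]) auto
  also have "\<dots> \<le> \<beta> * \<sigma> ^ k * (1 / (C * (1 - \<beta>)) + \<beta> / ((1 - 2 * \<beta>) * (1 - \<beta>)\<^sup>2))"
  proof -
    \<comment> \<open>One factor of the square is replaced by \<beta>; what remains is the left-hand
      side of \<open>contraction\<close> times the current error bound.\<close>
    have "(\<beta> * \<sigma> ^ k)\<^sup>2 / ((1 - 2 * \<beta>) * (1 - \<beta>)\<^sup>2) \<le> (\<beta> * \<sigma> ^ k * \<beta>) / ((1 - 2 * \<beta>) * (1 - \<beta>)\<^sup>2)"
      unfolding power2_eq_square[of "\<beta> * \<sigma> ^ k"] using l \<beta> by (intro divide_right_mono mult_left_mono) auto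
    then show ?thesis by (simp add: \<eta>_def distrib_left)
  qed
  also have "\<dots> \<le> \<beta> * \<sigma> ^ k * \<sigma>" using contraction l by (intro mult_left_mono) auto
  finally show ?case
    using s zn by (simp add: mult_ac)
qed

end

section \<open>Asymptotic cost in terms of the accuracy\<close>

definition iterations_for :: "real \<Rightarrow> real \<Rightarrow> real \<Rightarrow> nat" where
  "iterations_for \<beta> \<sigma> \<epsilon> = nat \<lceil>ln (\<beta> / \<epsilon>) / ln (1 / \<sigma>)\<rceil>"

context
  fixes \<beta> \<sigma> :: real
  assumes \<sigma>: "0 < \<sigma>" "\<sigma> < 1" and \<beta>: "0 < \<beta>"
begin

lemma ln_inverse_pos: "ln (1 / \<sigma>) > 0"
  using \<sigma> by simp

text \<open>Taking logarithms of \<beta> \<sigma>^k \<le> \<epsilon> and rounding up yields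
  \<open>iterations_for\<close>. If \<epsilon> > \<beta>, the logarithm is negative and
  \<open>nat\<close> returns at least as much, so 0 iterations suffice.\<close>

lemma iterations_for_accuracy:
  assumes "\<epsilon> > 0" shows "\<beta> * \<sigma> ^ iterations_for \<beta> \<sigma> \<epsilon> \<le> \<epsilon>"
proof -
  let ?k = "iterations_for \<beta> \<sigma> \<epsilon>"
  have "ln (\<beta> / \<epsilon>) / ln (1 / \<sigma>) \<le> real ?k" by (simp add: iterations_for_def of_nat_ceiling)
  then have "ln (\<beta> / \<epsilon>) \<le> real ?k * ln (1 / \<sigma>)" using ln_inverse_pos by (simp add: pos_divide_le_eq)
  also have "\<dots> = ln ((1 / \<sigma>) ^ ?k)" using \<sigma> by (simp add: ln_realpow)
  finally have "\<beta> / \<epsilon> \<le> (1 / \<sigma>) ^ ?k" using \<sigma> \<beta> assms by (subst (asm) ln_le_cancel_iff) auto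
  then show ?thesis using \<sigma> assms by (simp add: field_simps power_divide)
qed

lemma iterations_for_le:
  assumes "0 < \<epsilon>" "\<epsilon> < \<beta>" shows "real (iterations_for \<beta> \<sigma> \<epsilon>) \<le> ln (\<beta> / \<epsilon>) / ln (1 / \<sigma>) + 1"
proof -
  have "0 \<le> ln (\<beta> / \<epsilon>) / ln (1 / \<sigma>)" using assms ln_inverse_pos by (intro divide_nonneg_pos) auto
  then show ?thesis unfolding iterations_for_def by linarith
qed

lemma iterations_for_bigo:
  "(\<lambda>\<epsilon>. real (iterations_for \<beta> \<sigma> \<epsilon>)) \<in> O[at_right 0](\<lambda>\<epsilon>. ln (1 / \<epsilon>))"
proof (rule bigoI)
  define c where "c = (\<bar>ln \<beta>\<bar> + 1) / ln (1 / \<sigma>) + 1"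
  show "\<forall>\<^sub>F \<epsilon> in at_right 0. norm (real (iterations_for \<beta> \<sigma> \<epsilon>)) \<le> c * norm (ln (1 / \<epsilon>))"
    unfolding eventually_at_right_field
  proof (intro exI[of _ "min \<beta> (exp (-1))"] conjI allI impI)
    fix \<epsilon> :: real assume \<epsilon>: "0 < \<epsilon>" "\<epsilon> < min \<beta> (exp (-1))"
    \<comment> \<open>The threshold exp (-1) makes ln (1 / \<epsilon>) at least 1, so that additive
      constants can be absorbed.\<close>
    have "ln \<epsilon> < ln (exp (-1))" using \<epsilon> by (subst ln_less_cancel_iff) auto
    then have L: "1 \<le> ln (1 / \<epsilon>)" using \<epsilon> by (simp add: ln_div)
    have "ln (\<beta> / \<epsilon>) = ln \<beta> + ln (1 / \<epsilon>)" using \<epsilon> \<beta> by (simp add: ln_div)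
    also have "\<dots> \<le> \<bar>ln \<beta>\<bar> * ln (1 / \<epsilon>) + ln (1 / \<epsilon>)"
      using mult_left_mono[OF L, of "\<bar>ln \<beta>\<bar>"] by simp
    finally have "ln (\<beta> / \<epsilon>) \<le> (\<bar>ln \<beta>\<bar> + 1) * ln (1 / \<epsilon>)" by (simp add: algebra_simps)
    then have "ln (\<beta> / \<epsilon>) / ln (1 / \<sigma>) \<le> (\<bar>ln \<beta>\<bar> + 1) * ln (1 / \<epsilon>) / ln (1 / \<sigma>)"
      using ln_inverse_pos by (intro divide_right_mono) auto
    then have "real (iterations_for \<beta> \<sigma> \<epsilon>) \<le> (\<bar>ln \<beta>\<bar> + 1) * ln (1 / \<epsilon>) / ln (1 / \<sigma>) + ln (1 / \<epsilon>)"
      using iterations_for_le[of \<epsilon>] \<epsilon> L by simp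
    also have "\<dots> = c * ln (1 / \<epsilon>)" by (simp add: c_def distrib_right)
    finally show "norm (real (iterations_for \<beta> \<sigma> \<epsilon>)) \<le> c * norm (ln (1 / \<epsilon>))" using L by simp
  qed (use \<beta> in simp)
qed

text \<open>The costs grow geometrically with ratio \<sigma>^-2, so the sum is of the order of q^k,
  with k the number of outer iterations. Rounding up overshoots by at most one iteration, whence q^k
  \<le> (\<beta> / (\<sigma> \<epsilon>))^2. For \<epsilon> < 1 the exponent -2 may be lowered to -2
  \<nu>.\<close>

lemma geometric_cost_bigo:
  fixes a \<nu> :: real
  assumes a: "0 \<le> a" and \<nu>: "1 \<le> \<nu>"
  shows "(\<lambda>\<epsilon>. \<Sum>j<iterations_for \<beta> \<sigma> \<epsilon>. a / (\<sigma> ^ j)\<^sup>2 + 1) \<in> O[at_right 0](\<lambda>\<epsilon>. \<epsilon> powr (- 2 * \<nu>))"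
proof (rule bigoI)
  define q where "q = (1 / \<sigma>)\<^sup>2"
  have q: "q > 1" unfolding q_def using \<sigma> by (intro one_less_power) auto
  define c where "c = (a + 1) / (q - 1) * (\<beta> / \<sigma>)\<^sup>2"
  have c: "c \<ge> 0" unfolding c_def using a q by (intro mult_nonneg_nonneg divide_nonneg_pos) auto
  show "\<forall>\<^sub>F \<epsilon> in at_right 0. norm (\<Sum>j<iterations_for \<beta> \<sigma> \<epsilon>. a / (\<sigma> ^ j)\<^sup>2 + 1) \<le> c * norm (\<epsilon> powr (- 2 * \<nu>))"
    unfolding eventually_at_right_field
  proof (intro exI[of _ "min \<beta> 1"] conjI allI impI)
    fix \<epsilon> :: real assume \<epsilon>: "0 < \<epsilon>" "\<epsilon> < min \<beta> 1"
    let ?k = "iterations_for \<beta> \<sigma> \<epsilon>"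
    have "ln ((1 / \<sigma>) ^ ?k) = real ?k * ln (1 / \<sigma>)" using \<sigma> by (simp add: ln_realpow)
    also have "\<dots> \<le> (ln (\<beta> / \<epsilon>) / ln (1 / \<sigma>) + 1) * ln (1 / \<sigma>)"
      using iterations_for_le[of \<epsilon>] \<epsilon> ln_inverse_pos by (intro mult_right_mono) auto
    also have "\<dots> = ln (\<beta> / \<epsilon>) + ln (1 / \<sigma>)" using ln_inverse_pos by (simp add: distrib_right)
    also have "\<dots> = ln (\<beta> / \<sigma> * (1 / \<epsilon>))" using \<sigma> \<beta> \<epsilon> by (simp add: ln_div ln_mult)
    finally have "(1 / \<sigma>) ^ ?k \<le> \<beta> / \<sigma> * (1 / \<epsilon>)"
      using \<sigma> \<beta> \<epsilon> by (subst (asm) ln_le_cancel_iff) auto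
    then have "((1 / \<sigma>) ^ ?k)\<^sup>2 \<le> (\<beta> / \<sigma> * (1 / \<epsilon>))\<^sup>2" using \<sigma> by (intro power_mono) auto
    then have qk: "q ^ ?k \<le> (\<beta> / \<sigma>)\<^sup>2 * (1 / \<epsilon>)\<^sup>2"
      by (simp only: q_def power_mult_distrib power_mult[symmetric] mult.commute[of 2])
    have "(\<Sum>j<?k. a / (\<sigma> ^ j)\<^sup>2 + 1) \<le> (\<Sum>j<?k. (a + 1) * q ^ j)"
    proof (rule sum_mono)
      fix j
      have "a / (\<sigma> ^ j)\<^sup>2 = a * q ^ j"
        by (simp add: q_def power_divide power_mult[symmetric] mult.commute)
      moreover have "1 \<le> q ^ j" using q by simp
      ultimately show "a / (\<sigma> ^ j)\<^sup>2 + 1 \<le> (a + 1) * q ^ j" by (simp add: distrib_right)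
    qed
    also have "\<dots> = (a + 1) * ((q ^ ?k - 1) / (q - 1))"
      using q by (simp add: sum_distrib_left[symmetric] geometric_sum)
    also have "\<dots> \<le> (a + 1) * ((\<beta> / \<sigma>)\<^sup>2 * (1 / \<epsilon>)\<^sup>2 / (q - 1))"
      using a q qk by (intro mult_left_mono divide_right_mono) auto
    also have "\<dots> = c * \<epsilon> powr (- 2)"
      using \<epsilon> by (simp add: c_def powr_minus power_divide field_simps)
    also have "\<dots> \<le> c * \<epsilon> powr (- 2 * \<nu>)"
      using c \<epsilon> \<nu> by (intro mult_left_mono powr_mono') auto
    finally have "(\<Sum>j<?k. a / (\<sigma> ^ j)\<^sup>2 + 1) \<le> c * \<epsilon> powr (- 2 * \<nu>)" .
    moreover have "0 \<le> (\<Sum>j<?k. a / (\<sigma> ^ j)\<^sup>2 + 1)" using a by (intro sum_nonneg) simp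
    ultimately show "norm (\<Sum>j<?k. a / (\<sigma> ^ j)\<^sup>2 + 1) \<le> c * norm (\<epsilon> powr (- 2 * \<nu>))" by simp
  qed (use \<beta> in simp)
qed

end

text \<open>The cost bounds are chosen before the oracle, so the same bounds serve every way of
  breaking ties. The witnesses are the number of outer iterations, for both kinds of derivative
  evaluation, and the summed Frank-Wolfe bounds.\<close>

theorem theorem4p3:
  fixes f :: "real^'p \<Rightarrow> ereal"
    and X :: "(real^'p) set"
    and x0 xstar :: "real^'p"
    and \<sigma> \<beta> C :: real
  assumes "proper_fun f" and "closed_fun f" and "convex_fun f"
    and "C3_on_domain f"
    and "standard_self_concordant f"
    and "\<And>x. x \<in> edom f \<Longrightarrow> invertible (hessian (finite_part f) x)"
    and "X \<noteq> {}" and "compact X" and "convex X"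
    and "is_arg_min f (\<lambda>x. x \<in> X) xstar"
    and "x0 \<in> edom f \<inter> X"
    and "local_norm f xstar (x0 - xstar) \<le> \<beta>"
    and "\<sigma> \<in> {0<..<1}" and "\<beta> \<in> {0<..<1/2}" and "C > 1"
    and "1 / (C * (1 - \<beta>)) + \<beta> / ((1 - 2 * \<beta>) * (1 - \<beta>)\<^sup>2) \<le> \<sigma>"
    and "1 / C + 1 / (1 - 2 * \<beta>) \<le> 2"
  defines "\<eta> \<equiv> \<lambda>k::nat. \<beta> * \<sigma> ^ k / C"
    and "\<nu> \<equiv> 1 + ln (1 - 2 * \<beta>) / ln \<sigma>"
  shows "\<exists>(N_grad :: real \<Rightarrow> real) (N_hess :: real \<Rightarrow> real) (N_lmo :: real \<Rightarrow> real).
      N_grad \<in> O[at_right 0](\<lambda>\<epsilon>. ln (1 / \<epsilon>)) \<and>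
      N_hess \<in> O[at_right 0](\<lambda>\<epsilon>. ln (1 / \<epsilon>)) \<and>
      N_lmo \<in> O[at_right 0](\<lambda>\<epsilon>. \<epsilon> powr (- 2 * \<nu>)) \<and>
      (\<forall>lmo :: nat \<Rightarrow> nat \<Rightarrow> real^'p \<Rightarrow> real^'p. (\<forall>k t. is_LMO X (lmo k t)) \<longrightarrow>
        (\<forall>\<epsilon>>0. \<exists>k s. full_step f \<eta> lmo x0 k = Some s \<and>
          local_norm f xstar (iterate s - xstar) \<le> \<epsilon> \<and>
          real (gradient_evals s) \<le> N_grad \<epsilon> \<and>
          real (hessian_evals s) \<le> N_hess \<epsilon> \<and>
          real (lmo_calls s) \<le> N_lmo \<epsilon>))"
proof -
  interpret nondegenerate_self_concordant f
    by unfold_locales (fact assms)+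
  have \<sigma>: "0 < \<sigma>" "\<sigma> < 1" and \<beta>: "0 < \<beta>" "\<beta> < 1/2" using assms by auto
  have x0: "x0 \<in> edom f" "x0 \<in> X" using assms by auto
  then have "f xstar \<le> f x0" using \<open>is_arg_min f (\<lambda>x. x \<in> X) xstar\<close> by (auto simp: is_arg_min_linorder)
  then have xstar: "xstar \<in> edom f" using x0 by (auto simp: edom_def)
  \<comment> \<open>Both logarithms are negative, since 1 - 2 \<beta> and \<sigma> lie strictly
    between 0 and 1.\<close>
  have "ln (1 - 2 * \<beta>) / ln \<sigma> \<ge> 0" using \<sigma> \<beta> by (intro divide_nonpos_nonpos) auto
  then have \<nu>: "1 \<le> \<nu>" by (simp add: \<nu>_def)
  obtain K where K: "1 \<le> K" "\<And>x u v. local_norm f xstar (x - xstar) \<le> \<beta> \<Longrightarrow> u \<in> X \<Longrightarrow> v \<in> X \<Longrightarrow>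
      (v - u) \<bullet> (hessian (finite_part f) x *v (v - u)) \<le> K"
    using uniform_curvature_bound[OF xstar \<open>compact X\<close>, of \<beta>] \<beta> by auto
  define N where "N = iterations_for \<beta> \<sigma>"
  define N_lmo where "N_lmo = (\<lambda>\<epsilon>. \<Sum>j<N \<epsilon>. 4 * K / (\<eta> j)\<^sup>2 + 1)"
  have "N_lmo = (\<lambda>\<epsilon>. \<Sum>j<N \<epsilon>. (4 * K * C\<^sup>2 / \<beta>\<^sup>2) / (\<sigma> ^ j)\<^sup>2 + 1)"
    by (simp add: N_lmo_def \<eta>_def power_divide power_mult_distrib)
  then have "N_lmo \<in> O[at_right 0](\<lambda>\<epsilon>. \<epsilon> powr (- 2 * \<nu>))"
    unfolding N_def using geometric_cost_bigo[OF \<sigma> \<beta>(1) _ \<nu>, of "4 * K * C\<^sup>2 / \<beta>\<^sup>2"] K(1) by simp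
  moreover have "(\<lambda>\<epsilon>. real (N \<epsilon>)) \<in> O[at_right 0](\<lambda>\<epsilon>. ln (1 / \<epsilon>))"
    unfolding N_def by (rule iterations_for_bigo[OF \<sigma> \<beta>(1)])
  moreover have "\<exists>k s. full_step f \<eta> lmo x0 k = Some s \<and>
      local_norm f xstar (iterate s - xstar) \<le> \<epsilon> \<and>
      real (gradient_evals s) \<le> real (N \<epsilon>) \<and> real (hessian_evals s) \<le> real (N \<epsilon>) \<and>
      real (lmo_calls s) \<le> N_lmo \<epsilon>"
    if lmo: "\<forall>k t. is_LMO X (lmo k t)" and \<epsilon>: "\<epsilon> > 0" for lmo \<epsilon>
  proof -
    have "\<exists>s. full_step f \<eta> lmo x0 (N \<epsilon>) = Some s \<and> iterate s \<in> X \<and>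
        local_norm f xstar (iterate s - xstar) \<le> \<beta> * \<sigma> ^ N \<epsilon> \<and>
        gradient_evals s = N \<epsilon> \<and> hessian_evals s = N \<epsilon> \<and> real (lmo_calls s) \<le> N_lmo \<epsilon>"
      unfolding \<eta>_def N_lmo_def
      by (rule full_step_convergence[OF xstar \<open>convex X\<close> \<open>compact X\<close>
            \<open>is_arg_min f (\<lambda>x. x \<in> X) xstar\<close> x0(2) \<open>local_norm f xstar (x0 - xstar) \<le> \<beta>\<close>
            \<sigma> \<beta> \<open>C > 1\<close> \<open>1 / (C * (1 - \<beta>)) + \<beta> / ((1 - 2 * \<beta>) * (1 - \<beta>)\<^sup>2) \<le> \<sigma>\<close> K(1)])
        (use K(2) lmo in blast)+
    then obtain s where "full_step f \<eta> lmo x0 (N \<epsilon>) = Some s"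
      "local_norm f xstar (iterate s - xstar) \<le> \<beta> * \<sigma> ^ N \<epsilon>"
      "gradient_evals s = N \<epsilon>" "hessian_evals s = N \<epsilon>" "real (lmo_calls s) \<le> N_lmo \<epsilon>"
      by blast
    then show ?thesis
      using iterations_for_accuracy[OF \<sigma> \<beta>(1) \<epsilon>] unfolding N_def by force
  qed
  ultimately show ?thesis by blast
qed

end
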